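(* Let $r$ be a positive integer and $T=r^{5r^2}$. Then there exist a finite set $\mathcal{L}$ of lines and a finite point set $\mathcal{P}$ in $\mathbb{R}^2$ such that (i) every line of $\mathcal{L}$ contains at least $r$ points of $\mathcal{P}$; (ii) every point of $\mathcal{P}$ shares a line of $\mathcal{L}$ with at most $T$ other points of $\mathcal{P}$; (iii) $\mathcal{P}$ cannot be decomposed into two covering systems, i.e., there is no partition $\mathcal{P}=\mathcal{P}_1\cup\mathcal{P}_2$ such that every line of $\mathcal{L}$ contains a point of $\mathcal{P}_1$ and a point of $\mathcal{P}_2$. *)

theory Defs
  imports "HOL-Analysis.Analysis"
begin

definition is_line :: "(real \<times> real) set \<Rightarrow> bool" where
  "is_line L \<longleftrightarrow> (\<exists>p d. d \<noteq> (0,0) \<and> L = {p + t *\<^sub>R d | t. True})"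

end

theory Submission
  imports Defs "HOL-Computational_Algebra.Polynomial"
begin

text \<open>
  Take a sparse random set of points in a grid \<open>[N]\<^sup>D\<close> together with the axis-parallel lines that
  contain exactly \<open>r\<close> of them, and project generically to the plane. In any partition one class
  contains at least two fifths of the points, so it suffices that every such subset \<open>S\<close> contains a
  fixed proportion \<open>1 / k\<close> of the \<open>r\<close>-point lines. Reading the points of \<open>S\<close> one by one, either many of them
  complete many lines, or most of them fall into a set of density at most \<open>1 / 729\<close> determined by
  the earlier ones, which is too unlikely even after summing over all \<open>S\<close>. Finally a greedily chosen
  subfamily of \<open>k\<close> lines per point still meets the requirement, and discarding the few points of
  high degree bounds all degrees.
\<close>

text \<open>The obstacle is that one sample must serve all of its large parts at once. With
  \<open>n = 5 * r * Z\<close>, a large part has at least \<open>2 * r * Z\<close> entries. If it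
  completes at most \<open>Z\<close> lines, then at most \<open>Z\<close> of its entries are special
  at each of the \<open>r\<close> levels, so at least \<open>r * Z\<close> are ordinary. Weighting
  each ordinary entry by 729 costs a factor of at most 3 per sample entry: \<open>card V\<close> for
  leaving it out, \<open>card V\<close> for choosing it, and \<open>card V\<close> for the weight on
  a set of density \<open>1 / 729\<close>. The balance is \<open>3 ^ (5 * r * Z)\<close> against
  \<open>729 ^ (r * Z) = 3 ^ (6 * r * Z)\<close>. The constants look circular: the thresholds that
  govern the levels grow with \<open>k\<close>, and so does the degree \<open>D\<close>, while
  \<open>k\<close> must exceed the ratio of all \<open>r\<close>-point lines to those inside a part.
  The way out is \<open>D = 4 * k ^ (r - 1) * G\<close> with \<open>G\<close> free of
  \<open>k\<close>. There are \<open>D * n * k\<close> lines, each receiving \<open>r\<close>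
  entries with probability at most \<open>k ^ (-r)\<close>, so about \<open>4 * G * n\<close> of
  them are expected, a bound linear in \<open>n\<close> without \<open>k\<close>. Hence
  \<open>k = 120 * r * G\<close> can be fixed after \<open>G\<close>.\<close>

lemma sum_card_swap:
  assumes "finite X" "finite A"
  shows "(\<Sum>v\<in>X. card {L\<in>A. Q v L}) = (\<Sum>L\<in>A. card {v\<in>X. Q v L})"
proof -
  have "(\<Sum>v\<in>X. card {L\<in>A. Q v L}) = (\<Sum>v\<in>X. \<Sum>L\<in>A. if Q v L then 1 else 0)"
    using assms by (intro sum.cong refl) (simp add: sum.If_cases Int_def)
  also have "\<dots> = (\<Sum>L\<in>A. \<Sum>v\<in>X. if Q v L then 1 else 0)"
    by (rule sum.swap)
  also have "\<dots> = (\<Sum>L\<in>A. card {v\<in>X. Q v L})"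
    using assms by (intro sum.cong refl) (simp add: sum.If_cases Int_def)
  finally show ?thesis .
qed

lemma sum_card_incidence:
  assumes "finite X" "finite A"
  shows "(\<Sum>v\<in>X. card {L\<in>A. v \<in> L}) = (\<Sum>L\<in>A. card (L \<inter> X))"
  using sum_card_swap[OF assms, of "(\<in>)"] by (simp add: Int_def conj_commute)

section \<open>Regular uniform linear hypergraphs\<close>

locale linear_hypergraph =
  fixes V :: "'v set" and Ls :: "'v set set" and N D :: nat
  assumes finV: "finite V"
    and Ls_sub: "L \<in> Ls \<Longrightarrow> L \<subseteq> V"
    and card_line: "L \<in> Ls \<Longrightarrow> card L = N"
    and degree: "v \<in> V \<Longrightarrow> card {L\<in>Ls. v \<in> L} = D"
    and linear: "\<lbrakk>L \<in> Ls; L' \<in> Ls; L \<noteq> L'; x \<in> L; x \<in> L'; y \<in> L; y \<in> L'\<rbrakk> \<Longrightarrow> x = y"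
begin

lemma finLs: "finite Ls"
  using finV Ls_sub by (meson Pow_iff finite_Pow_iff finite_subset subsetI)

lemma card_Ls: "card Ls * N = D * card V"
proof -
  have "(\<Sum>v\<in>V. card {L\<in>Ls. v \<in> L}) = (\<Sum>L\<in>Ls. card (L \<inter> V))"
    by (rule sum_card_incidence[OF finV finLs])
  moreover have "\<dots> = (\<Sum>L\<in>Ls. N)"
    using Ls_sub card_line by (intro sum.cong refl) (simp add: Int_absorb2)
  ultimately show ?thesis using degree by (simp add: mult.commute)
qed

end

section \<open>Levels of lines and the set of ordinary vertices\<close>

text \<open>A list \<open>x # xs\<close> is read from its tail. A line climbs from level \<open>j\<close> to \<open>j + 1\<close> when it
  receives a new point, but below level \<open>r\<close> only as long as it still has more than \<open>q (j + 1)\<close>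
  vertices lying on fewer than \<open>a (j + 1)\<close> lines of level \<open>j + 1\<close>. This restriction keeps the number
  of lines of level \<open>j\<close> at most \<open>a j * card V / q j\<close>.\<close>

locale line_levels = linear_hypergraph V Ls N D
  for V :: "'v set" and Ls :: "'v set set" and N D :: nat +
  fixes r :: nat and a b q :: "nat \<Rightarrow> nat"
  assumes r_pos: "0 < r"
    and a_0: "a 0 = D" and q_0: "q 0 = N"
    and a_step: "Suc j < r \<Longrightarrow> a (Suc j) + 2 * b j \<le> a j"
    and a_last: "b (r - 1) \<le> a (r - 1)"
begin

definition unsat :: "('v set \<Rightarrow> nat) \<Rightarrow> nat \<Rightarrow> 'v set" where
  "unsat f j = {v\<in>V. card {L\<in>Ls. v \<in> L \<and> j \<le> f L} < a j}"

text \<open>The inequality is strict because the vertex that lifts the line is itself discarded when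
  gains are counted in \<open>num_load_bound\<close>. The climb to level \<open>r\<close> is
  unrestricted; the number of full lines is bounded by hypothesis where it matters.\<close>

definition open_line :: "('v set \<Rightarrow> nat) \<Rightarrow> 'v set \<Rightarrow> bool" where
  "open_line f L \<longleftrightarrow> (Suc (f L) < r \<longrightarrow> q (Suc (f L)) < card (L \<inter> unsat f (Suc (f L))))"

primrec lev :: "'v list \<Rightarrow> 'v set \<Rightarrow> nat" where
  "lev [] = (\<lambda>L. 0)"
| "lev (x # xs) = (\<lambda>L. if x \<notin> set xs \<and> x \<in> L \<and> open_line (lev xs) L
                        then Suc (lev xs L) else lev xs L)"

definition num :: "'v list \<Rightarrow> nat \<Rightarrow> nat" where
  "num xs j = card {L\<in>Ls. j \<le> lev xs L}"

definition prom :: "'v list \<Rightarrow> nat \<Rightarrow> 'v \<Rightarrow> 'v set set" where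
  "prom xs j x = {L\<in>Ls. x \<in> L \<and> lev xs L = j \<and> open_line (lev xs) L}"

definition special :: "'v list \<Rightarrow> nat \<Rightarrow> 'v \<Rightarrow> bool" where
  "special xs j x \<longleftrightarrow> x \<notin> set xs \<and> b j \<le> card (prom xs j x)"

text \<open>A new vertex is special if it lifts many lines at once. Special steps are few because each of
  them consumes part of the bounded number of lines of the next level, and all other steps have
  to stay inside a small set of vertices.\<close>

primrec num_special :: "nat \<Rightarrow> 'v list \<Rightarrow> nat" where
  "num_special j [] = 0"
| "num_special j (x # xs) = num_special j xs + (if special xs j x then 1 else 0)"

text \<open>A repeated vertex is never special, so it counts as ordinary;
  \<open>ordinary_cover\<close> allows for it by including \<open>set xs\<close>.\<close>

primrec num_ordinary :: "'v list \<Rightarrow> nat" where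
  "num_ordinary [] = 0"
| "num_ordinary (x # xs) = num_ordinary xs + (if \<exists>j<r. special xs j x then 0 else 1)"

lemma lev_le_card: "L \<in> Ls \<Longrightarrow> lev xs L \<le> card (L \<inter> set xs)"
proof (induction xs)
  case (Cons x xs)
  have "finite (L \<inter> set xs)" by simp
  then show ?case using Cons by (auto simp: Int_insert_right card_insert_if)
qed simp

lemma num_Cons_eq:
  assumes "x \<notin> set xs"
  shows "num (x # xs) (Suc j) = num xs (Suc j) + card (prom xs j x)"
proof -
  have "{L\<in>Ls. Suc j \<le> lev (x # xs) L} = {L\<in>Ls. Suc j \<le> lev xs L} \<union> prom xs j x"
    using assms by (auto simp: prom_def not_less_eq_eq le_Suc_eq split: if_splits)
  moreover have "{L\<in>Ls. Suc j \<le> lev xs L} \<inter> prom xs j x = {}"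
    by (auto simp: prom_def)
  ultimately show ?thesis
    unfolding num_def using finLs by (subst card_Un_disjoint[symmetric]) (auto simp: prom_def)
qed

lemma num_Cons_old: "x \<in> set xs \<Longrightarrow> num (x # xs) j = num xs j"
  by (simp add: num_def)

lemma num_mono: "num xs j \<le> num (x # xs) j"
  unfolding num_def using finLs by (intro card_mono) auto

lemma special_bound: "b j * num_special j xs \<le> num xs (Suc j)"
proof (induction xs)
  case (Cons x xs)
  show ?case
  proof (cases "special xs j x")
    case True
    then have "b j \<le> card (prom xs j x)" "x \<notin> set xs" by (auto simp: special_def)
    then show ?thesis using Cons True num_Cons_eq[of x xs j] by simp
  next
    case False
    then show ?thesis using Cons num_mono[of xs "Suc j" x] by simp
  qed
qed simp

lemma length_le: "length xs \<le> num_ordinary xs + (\<Sum>j<r. num_special j xs)"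
proof (induction xs)
  case (Cons x xs)
  have "(\<Sum>j<r. num_special j (x # xs)) = (\<Sum>j<r. num_special j xs) + (\<Sum>j<r. if special xs j x then 1 else 0)"
    by (simp add: sum.distrib)
  moreover have "1 \<le> (\<Sum>j<r. if special xs j x then 1 else 0::nat)" if "\<exists>j<r. special xs j x"
  proof -
    from that obtain i where "i < r" "special xs i x" by blast
    then show ?thesis
      using member_le_sum[of i "{..<r}" "\<lambda>j. if special xs j x then 1 else 0::nat"] by simp
  qed
  ultimately have "(if \<exists>j<r. special xs j x then 1 else 0) + (\<Sum>j<r. num_special j xs)
      \<le> (\<Sum>j<r. num_special j (x # xs))"
    by (cases "\<exists>j<r. special xs j x") simp_all
  then show ?case
    using Cons by (cases "\<exists>j<r. special xs j x") (auto simp del: num_special.simps)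
qed simp

definition load :: "'v list \<Rightarrow> nat \<Rightarrow> 'v \<Rightarrow> nat" where
  "load xs j v = card {L\<in>Ls. v \<in> L \<and> j \<le> lev xs L}"

lemma unsat_lev: "unsat (lev xs) j = {v\<in>V. load xs j v < a j}"
  by (simp add: unsat_def load_def)

text \<open>The right-hand side is a potential. A line climbing to level \<open>Suc j\<close> had
  more than \<open>q (Suc j)\<close> vertices with load below the cap \<open>a (Suc j)\<close>, and
  the truncated load of each of them grows.\<close>

lemma num_load_bound:
  assumes "Suc j < r"
  shows "q (Suc j) * num xs (Suc j) \<le> (\<Sum>v\<in>V. min (load xs (Suc j) v) (a (Suc j)))"
proof (induction xs)
  case Nil
  then show ?case by (simp add: num_def)
next
  case (Cons x xs)
  let ?k = "Suc j"
  let ?g = "\<lambda>xs v. min (load xs ?k v) (a ?k)"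
  let ?A = "unsat (lev xs) ?k"
  have load_mono: "load xs ?k v \<le> load (x # xs) ?k v" for v
    unfolding load_def using finLs by (intro card_mono) auto
  then have g_mono: "?g xs v \<le> ?g (x # xs) v" for v
    using min.mono by blast
  show ?case
  proof (cases "x \<in> set xs")
    case True
    then have "load (x # xs) ?k v = load xs ?k v" for v by (simp add: load_def)
    then show ?thesis using Cons num_Cons_old[OF True] by simp
  next
    case False
    \<comment> \<open>By linearity the lifted lines meet only in \<open>x\<close>. Without
      \<open>x\<close> their unsaturated parts are disjoint, so the gains add up.\<close>
    let ?U = "\<Union>L\<in>prom xs j x. (L \<inter> ?A) - {x}"
    have pL: "L \<in> Ls" "x \<in> L" if "L \<in> prom xs j x" for L using that by (auto simp: prom_def)
    have finp: "finite (prom xs j x)" using finLs by (auto simp: prom_def)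
    have finA: "finite ?A" using finV by (auto simp: unsat_def)
    have "q ?k * card (prom xs j x) = (\<Sum>L\<in>prom xs j x. q ?k)" by simp
    also have "\<dots> \<le> (\<Sum>L\<in>prom xs j x. card ((L \<inter> ?A) - {x}))"
    proof (rule sum_mono)
      fix L assume "L \<in> prom xs j x"
      then have "q ?k < card (L \<inter> ?A)"
        using assms by (auto simp: prom_def open_line_def)
      moreover have "card (L \<inter> ?A) - card {x} \<le> card ((L \<inter> ?A) - {x})"
        by (rule diff_card_le_card_Diff) simp
      ultimately show "q ?k \<le> card ((L \<inter> ?A) - {x})" by simp
    qed
    also have "\<dots> = card ?U"
    proof (rule card_UN_disjoint[symmetric])
      show "\<forall>L\<in>prom xs j x. \<forall>L'\<in>prom xs j x. L \<noteq> L' \<longrightarrow>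
          ((L \<inter> ?A) - {x}) \<inter> ((L' \<inter> ?A) - {x}) = {}"
        using pL linear by blast
    qed (use finp finA in auto)
    finally have 1: "q ?k * card (prom xs j x) \<le> card ?U" .
    have U: "?U \<subseteq> V" using pL Ls_sub by blast
    have step: "?g xs v + 1 \<le> ?g (x # xs) v" if "v \<in> ?U" for v
    proof -
      from that obtain L where L: "L \<in> prom xs j x" "v \<in> L" "v \<in> ?A" by blast
      have "L \<notin> {L\<in>Ls. v \<in> L \<and> ?k \<le> lev xs L}" using L by (auto simp: prom_def)
      moreover have "insert L {L\<in>Ls. v \<in> L \<and> ?k \<le> lev xs L} \<subseteq> {L\<in>Ls. v \<in> L \<and> ?k \<le> lev (x # xs) L}"
        using L False by (auto simp: prom_def)
      ultimately have "Suc (load xs ?k v) \<le> load (x # xs) ?k v"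
        unfolding load_def using finLs card_mono[of "{L\<in>Ls. v \<in> L \<and> ?k \<le> lev (x # xs) L}"
            "insert L {L\<in>Ls. v \<in> L \<and> ?k \<le> lev xs L}"] by simp
      moreover have "load xs ?k v < a ?k" using L by (simp add: unsat_lev)
      ultimately show ?thesis by simp
    qed
    have cardU: "card W = (\<Sum>v\<in>V. if v \<in> W then 1 else 0)" if "W \<subseteq> V" for W
      using that finV by (simp add: sum.If_cases Int_absorb1)
    have "(\<Sum>v\<in>V. ?g xs v) + card ?U = (\<Sum>v\<in>V. ?g xs v + (if v \<in> ?U then 1 else 0))"
      unfolding cardU[OF U] by (rule sum.distrib[symmetric])
    also have "\<dots> \<le> (\<Sum>v\<in>V. ?g (x # xs) v)"
    proof (rule sum_mono)
      fix v
      show "?g xs v + (if v \<in> ?U then 1 else 0) \<le> ?g (x # xs) v"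
      proof (cases "v \<in> ?U")
        case True
        then show ?thesis using step[OF True] by (simp only: if_True)
      next
        case False
        then show ?thesis using g_mono[of v] by (simp only: if_False add_0_right)
      qed
    qed
    finally show ?thesis
      using Cons 1 num_Cons_eq[OF False, of j] by (simp add: distrib_left)
  qed
qed

lemma num_bound:
  assumes "j < r"
  shows "q j * num xs j \<le> a j * card V"
proof (cases j)
  case 0
  then show ?thesis using card_Ls by (simp add: num_def a_0 q_0 mult.commute)
next
  case (Suc i)
  have "q j * num xs j \<le> (\<Sum>v\<in>V. min (load xs j v) (a j))"
    using num_load_bound[of i] assms Suc by simp
  also have "\<dots> \<le> (\<Sum>v\<in>V. a j)" by (intro sum_mono) simp
  finally show ?thesis by (simp add: mult.commute)
qed

definition stuck :: "'v list \<Rightarrow> nat \<Rightarrow> 'v set" where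
  "stuck xs j = {v \<in> unsat (lev xs) (Suc j).
     b j \<le> card {L\<in>Ls. v \<in> L \<and> lev xs L = j \<and> \<not> open_line (lev xs) L}}"

text \<open>Double counting of incidences between stuck vertices and closed lines of level
  \<open>j\<close>: a closed line has at most \<open>q (Suc j)\<close> unsaturated vertices.\<close>

lemma stuck_bound:
  assumes "Suc j < r"
  shows "b j * card (stuck xs j) \<le> q (Suc j) * num xs j"
proof -
  let ?E = "{L\<in>Ls. lev xs L = j \<and> \<not> open_line (lev xs) L}"
  have fin: "finite (stuck xs j)" "finite ?E" using finV finLs by (auto simp: stuck_def unsat_def)
  have "b j * card (stuck xs j) = (\<Sum>v\<in>stuck xs j. b j)" by simp
  also have "\<dots> \<le> (\<Sum>v\<in>stuck xs j. card {L\<in>?E. v \<in> L})"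
    by (rule sum_mono) (auto simp: stuck_def conj_commute conj_left_commute intro!: order_trans[OF _ card_mono] finLs)
  also have "\<dots> = (\<Sum>L\<in>?E. card (L \<inter> stuck xs j))" by (rule sum_card_incidence[OF fin])
  also have "\<dots> \<le> (\<Sum>L\<in>?E. q (Suc j))"
  proof (rule sum_mono)
    fix L assume L: "L \<in> ?E"
    have "card (L \<inter> stuck xs j) \<le> card (L \<inter> unsat (lev xs) (Suc j))"
      using finV by (intro card_mono) (auto simp: stuck_def unsat_def)
    also have "\<dots> \<le> q (Suc j)" using L assms by (auto simp: open_line_def)
    finally show "card (L \<inter> stuck xs j) \<le> q (Suc j)" .
  qed
  also have "\<dots> \<le> q (Suc j) * num xs j"
    unfolding num_def using finLs by (auto intro!: card_mono)
  finally show ?thesis .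
qed

text \<open>For a new vertex on no full line, take the highest level \<open>j < r\<close> with load
  at least \<open>a j\<close>; level 0 qualifies as \<open>a 0 = D\<close>. If
  \<open>Suc j < r\<close>, then more than \<open>2 * b j\<close> lines through \<open>v\<close>
  have level exactly \<open>j\<close>, and fewer than \<open>b j\<close> of them are open since
  \<open>v\<close> is not special, so \<open>v\<close> is stuck. If \<open>j = r - 1\<close>, all
  these lines are open and \<open>v\<close> would be special.\<close>

lemma ordinary_cover:
  assumes v: "v \<in> V" "\<not> (\<exists>j<r. special xs j v)"
  shows "v \<in> set xs \<union> \<Union>{L\<in>Ls. r \<le> lev xs L} \<union> (\<Union>j<r-1. stuck xs j)"
proof (rule ccontr)
  assume out: "\<not> ?thesis"
  then have new: "v \<notin> set xs" and low: "\<And>L. L \<in> Ls \<Longrightarrow> v \<in> L \<Longrightarrow> lev xs L < r" by force+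
  let ?P = "\<lambda>j. j < r \<and> a j \<le> load xs j v"
  have "?P 0" using r_pos v degree[of v] by (simp add: load_def a_0)
  then obtain j where j: "?P j" and jmax: "\<And>i. ?P i \<Longrightarrow> i \<le> j"
    using Nat.ex_has_greatest_nat[of ?P 0 r] by (metis less_imp_le)
  let ?X = "{L\<in>Ls. v \<in> L \<and> lev xs L = j}"
  let ?Y = "{L\<in>Ls. v \<in> L \<and> lev xs L = j \<and> \<not> open_line (lev xs) L}"
  have split: "card ?X \<le> card (prom xs j v) + card ?Y"
    using finLs by (intro order_trans[OF card_mono card_Un_le]) (auto simp: prom_def)
  have ns: "card (prom xs j v) < b j" using v j new by (auto simp: special_def)
  show False
  proof (cases "Suc j < r")
    case True
    then have less: "load xs (Suc j) v < a (Suc j)" using jmax[of "Suc j"] by force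
    have "load xs j v \<le> card ?X + load xs (Suc j) v"
      unfolding load_def using finLs
      by (intro order_trans[OF card_mono card_Un_le]) auto
    then have "b j \<le> card ?Y" using less j split ns a_step[OF True] by linarith
    then have "v \<in> stuck xs j" using less v by (simp add: stuck_def unsat_lev)
    then show False using out True by auto
  next
    case False
    then have jr: "j = r - 1" using j by linarith
    have "load xs j v \<le> card ?X"
      unfolding load_def using finLs low jr by (intro card_mono) force+
    moreover have "?Y = {}" using False by (auto simp: open_line_def)
    then have "card ?Y = 0" by (simp only: card.empty)
    ultimately show False using split ns j a_last jr by simp
  qed
qed

lemma card_ordinary:
  "card {v\<in>V. \<not> (\<exists>j<r. special xs j v)} \<le> length xs + N * num xs r + (\<Sum>j<r-1. card (stuck xs j))"
proof -
  let ?H = "{L\<in>Ls. r \<le> lev xs L}"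
  have fin: "finite (stuck xs j)" for j using finV by (simp add: stuck_def unsat_def)
  have finH: "finite ?H" "finite (\<Union>?H)" using finLs finV Ls_sub by (auto intro: finite_subset)
  have "card {v\<in>V. \<not> (\<exists>j<r. special xs j v)} \<le> card (set xs \<union> \<Union>?H \<union> (\<Union>j<r-1. stuck xs j))"
    using fin finH ordinary_cover[of _ xs] by (intro card_mono) blast+
  also have "\<dots> \<le> card (set xs \<union> \<Union>?H) + card (\<Union>j<r-1. stuck xs j)" by (rule card_Un_le)
  also have "\<dots> \<le> card (set xs) + card (\<Union>?H) + card (\<Union>j<r-1. stuck xs j)"
    by (intro add_right_mono card_Un_le)
  also have "\<dots> \<le> length xs + N * num xs r + (\<Sum>j<r-1. card (stuck xs j))"
  proof (intro add_mono card_length)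
    have "card (\<Union>?H) \<le> (\<Sum>L\<in>?H. card L)" by (rule card_Union_le_sum_card)
    also have "\<dots> = (\<Sum>L\<in>?H. N)" using card_line by (intro sum.cong) auto
    finally show "card (\<Union>?H) \<le> N * num xs r" by (simp add: num_def mult.commute)
    show "card (\<Union>j<r-1. stuck xs j) \<le> (\<Sum>j<r-1. card (stuck xs j))" by (rule card_UN_le) simp
  qed
  finally show ?thesis .
qed

end

section \<open>Moments of uniformly random lists\<close>

lemma sum_lists_Suc:
  "(\<Sum>ys | set ys \<subseteq> X \<and> length ys = Suc n. f ys) =
   (\<Sum>ys | set ys \<subseteq> X \<and> length ys = n. \<Sum>x\<in>X. f (x # ys))"
proof -
  have img: "{ys. set ys \<subseteq> X \<and> length ys = Suc n} =
      (\<lambda>(ys, x). x # ys) ` ({ys. set ys \<subseteq> X \<and> length ys = n} \<times> X)"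
    by (force simp: length_Suc_conv image_iff)
  have "inj_on (\<lambda>(ys, x). x # ys) ({ys. set ys \<subseteq> X \<and> length ys = n} \<times> X)"
    by (auto simp: inj_on_def)
  then show ?thesis
    unfolding img by (simp add: sum.reindex sum.cartesian_product case_prod_unfold)
qed

text \<open>This is the binomial moment of the number of hits in \<open>L\<close> of a random list,
  multiplied out to stay in the naturals. Pascal's rule for the first entry drives the
  induction.\<close>

lemma sum_choose_filter:
  fixes X :: "'v set"
  assumes "finite X" "L \<subseteq> X"
  shows "(\<Sum>ys | set ys \<subseteq> X \<and> length ys = n. length (filter (\<lambda>y. y \<in> L) ys) choose s) * card X ^ s
    = (n choose s) * card L ^ s * card X ^ n"
proof (induction n arbitrary: s)
  case 0
  have "{ys. set ys \<subseteq> X \<and> length ys = 0} = {[]}" by auto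
  then show ?case by (cases s) simp_all
next
  case (Suc n)
  show ?case
  proof (cases s)
    case 0
    then show ?thesis using card_lists_length_eq[OF assms(1), of "Suc n"] by simp
  next
    case (Suc s')
    let ?c = "\<lambda>ys. length (filter (\<lambda>y. y \<in> L) ys)"
    let ?U = "{ys. set ys \<subseteq> X \<and> length ys = n}"
    have inner: "(\<Sum>x\<in>X. ?c (x # ys) choose Suc s') =
        card X * (?c ys choose Suc s') + card L * (?c ys choose s')" for ys
    proof -
      have "(\<Sum>x\<in>X. ?c (x # ys) choose Suc s') =
          (\<Sum>x\<in>X. (?c ys choose Suc s') + (if x \<in> L then ?c ys choose s' else 0))"
        by (intro sum.cong refl) simp
      also have "\<dots> = card X * (?c ys choose Suc s') + card L * (?c ys choose s')"
        using assms by (simp add: sum.distrib sum.If_cases Int_absorb1)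
      finally show ?thesis .
    qed
    have "(\<Sum>ys | set ys \<subseteq> X \<and> length ys = Suc n. ?c ys choose s) * card X ^ s =
        card X * ((\<Sum>ys\<in>?U. ?c ys choose Suc s') * card X ^ Suc s')
        + card L * card X * ((\<Sum>ys\<in>?U. ?c ys choose s') * card X ^ s')"
      unfolding sum_lists_Suc inner Suc
      by (simp add: sum.distrib sum_distrib_left[symmetric] algebra_simps)
    also have "\<dots> = (Suc n choose s) * card L ^ s * card X ^ Suc n"
      unfolding Suc.IH Suc by (simp add: algebra_simps)
    finally show ?thesis .
  qed
qed

lemma markov_card:
  fixes g :: "'b \<Rightarrow> nat"
  assumes "finite U" "m * sum g U \<le> c * card U" "0 < c"
  shows "m * card {y\<in>U. c < g y} \<le> card U"
proof -
  have "c * card {y\<in>U. c < g y} = (\<Sum>y | y \<in> U \<and> c < g y. c)" by simp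
  also have "\<dots> \<le> (\<Sum>y | y \<in> U \<and> c < g y. g y)" by (intro sum_mono) auto
  also have "\<dots> \<le> sum g U" using assms(1) by (intro sum_mono2) auto
  finally have "m * (c * card {y\<in>U. c < g y}) \<le> m * sum g U" by (rule mult_le_mono2)
  then have "c * (m * card {y\<in>U. c < g y}) \<le> c * card U"
    using assms(2) unfolding mult.left_commute[of c m] by (rule le_trans)
  then show ?thesis using assms(3) by (metis nat_mult_le_cancel1)
qed

section \<open>Exponential moment of the number of ordinary entries\<close>

context line_levels
begin

definition mask :: "('v \<times> bool) list \<Rightarrow> 'v list" where
  "mask zs = map fst (filter snd zs)"

text \<open>The Boolean component of a list entry records whether the vertex belongs to the chosen part
  of the sample; summing over it replaces a union bound over all parts.\<close>

lemma ordinary_moment: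
  assumes few: "\<And>xs. length xs \<le> n \<Longrightarrow> num xs r \<le> Z \<Longrightarrow>
      card {v\<in>V. \<not> (\<exists>j<r. special xs j v)} \<le> f"
    and "t \<le> n"
  shows "(\<Sum>zs | set zs \<subseteq> V \<times> UNIV \<and> length zs = t.
      if num (mask zs) r \<le> Z then w ^ num_ordinary (mask zs) else 0) \<le> (2 * card V + w * f) ^ t"
  using assms(2)
proof (induction t)
  case 0
  have eq: "{zs::('v \<times> bool) list. set zs \<subseteq> V \<times> UNIV \<and> length zs = 0} = {[]}" by auto
  show ?case unfolding eq by (simp add: mask_def)
next
  case (Suc t)
  let ?g = "\<lambda>zs. if num (mask zs) r \<le> Z then w ^ num_ordinary (mask zs) else 0"
  let ?c = "2 * card V + w * f"
  have step: "(\<Sum>z\<in>V \<times> UNIV. ?g (z # zs)) \<le> ?c * ?g zs" if "length zs = t" for zs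
  proof (cases "num (mask zs) r \<le> Z")
    case False
    \<comment> \<open>The number of full lines never decreases, so a list beyond \<open>Z\<close>
      contributes nothing from then on.\<close>
    then have "\<not> num (x # mask zs) r \<le> Z" for x using num_mono[of "mask zs" r x] by linarith
    then have "?g (z # zs) = 0" for z using False by (cases z) (auto simp: mask_def)
    then show ?thesis by simp
  next
    case True
    let ?xs = "mask zs"
    let ?O = "{v\<in>V. \<not> (\<exists>j<r. special ?xs j v)}"
    have "length ?xs \<le> n" using that Suc.prems
      unfolding mask_def by (metis length_filter_le length_map le_trans Suc_leD)
    then have O: "card ?O \<le> f" using True few by simp
    have "(\<Sum>z\<in>V \<times> UNIV. ?g (z # zs)) = (\<Sum>v\<in>V. \<Sum>c\<in>UNIV. ?g ((v, c) # zs))"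
      by (simp add: sum.cartesian_product)
    also have "\<dots> = (\<Sum>v\<in>V. ?g ((v, False) # zs) + ?g ((v, True) # zs))"
      by (simp add: UNIV_bool)
    \<comment> \<open>The summand 2 stands for the two values of the mark; the extra
      \<open>w\<close> is needed only when an ordinary vertex is chosen.\<close>
    also have "\<dots> \<le> (\<Sum>v\<in>V. w ^ num_ordinary ?xs * (2 + (if v \<in> ?O then w else 0)))"
    proof (rule sum_mono)
      fix v assume "v \<in> V"
      have "?g ((v, False) # zs) = w ^ num_ordinary ?xs" using True by (simp add: mask_def)
      moreover have "?g ((v, True) # zs) \<le> w ^ num_ordinary (v # ?xs)" by (simp add: mask_def)
      moreover have "w ^ num_ordinary (v # ?xs) \<le> w ^ num_ordinary ?xs * (1 + (if v \<in> ?O then w else 0))"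
        using \<open>v \<in> V\<close> by auto
      ultimately show "?g ((v, False) # zs) + ?g ((v, True) # zs)
          \<le> w ^ num_ordinary ?xs * (2 + (if v \<in> ?O then w else 0))"
        by (simp only: distrib_left)
    qed
    also have "\<dots> = w ^ num_ordinary ?xs * (2 * card V + w * card ?O)"
    proof -
      have "(\<Sum>v\<in>V. if v \<in> ?O then w else 0) = card (V \<inter> {v. v \<in> ?O}) * w"
        using finV by (subst sum.If_cases) simp_all
      also have "V \<inter> {v. v \<in> ?O} = ?O" by blast
      finally show ?thesis by (simp only: sum_distrib_left[symmetric] sum.distrib) simp
    qed
    also have "\<dots> \<le> ?c * ?g zs" using O True by simp
    finally show ?thesis .
  qed
  have "(\<Sum>zs | set zs \<subseteq> V \<times> UNIV \<and> length zs = Suc t. ?g zs)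
      \<le> (\<Sum>zs | set zs \<subseteq> V \<times> UNIV \<and> length zs = t. ?c * ?g zs)"
    unfolding sum_lists_Suc by (rule sum_mono) (use step in simp)
  also have "\<dots> = ?c * (\<Sum>zs | set zs \<subseteq> V \<times> UNIV \<and> length zs = t. ?g zs)"
    by (rule sum_distrib_left[symmetric])
  also have "\<dots> \<le> ?c * ?c ^ t" using Suc by (intro mult_le_mono2) simp
  finally show ?case by simp
qed

text \<open>A part is given by positions rather than vertices, because a sample may repeat a
  vertex.\<close>

definition sub :: "'v list \<Rightarrow> nat set \<Rightarrow> 'v list" where
  "sub ys S = map ((!) ys) (filter (\<lambda>t. t \<in> S) [0..<length ys])"

lemma set_sub: "S \<subseteq> {..<length ys} \<Longrightarrow> set (sub ys S) = (!) ys ` S"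
  by (auto simp: sub_def)

lemma length_sub: "S \<subseteq> {..<length ys} \<Longrightarrow> length (sub ys S) = card S"
proof -
  assume "S \<subseteq> {..<length ys}"
  then have "{0..<length ys} \<inter> S = S" by auto
  moreover have "length (filter (\<lambda>t. t \<in> S) [0..<length ys]) = card (set (filter (\<lambda>t. t \<in> S) [0..<length ys]))"
    by (rule distinct_card[symmetric]) simp
  ultimately show ?thesis by (simp add: sub_def Int_def)
qed

lemma sub_eq_mask: "sub ys S = mask (map (\<lambda>t. (ys ! t, t \<in> S)) [0..<length ys])"
  by (simp add: sub_def mask_def filter_map comp_def)

end

section \<open>Choice of a sample that is good for all its large parts\<close>

text \<open>A sample is a list of \<open>n\<close> vertices, and the expected number of them on a line is \<open>1 / k\<close>.
  The point of \<open>k\<close> being large is that lines receiving more than \<open>r\<close> vertices are negligible even against the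
  lines contained in an arbitrary half of the sample.\<close>

locale sampling = line_levels V Ls N D r a b q
  for V :: "'v set" and Ls :: "'v set set" and N D r :: nat and a b q :: "nat \<Rightarrow> nat" +
  fixes R k n Z G :: nat
  assumes a_eq: "a j = 4 * b j"
    and b_pos: "0 < b j" and q_pos: "0 < q j"
    and q_step: "Suc j < r \<Longrightarrow> q j = R * q (Suc j)"
    and b_step: "Suc j < r \<Longrightarrow> b j * q (Suc j) = 20 * k * r * N * b (Suc j)"
    and b_last: "b (r - 1) = 1"
    and Z_pos: "0 < Z"
    and n_eq: "n = 5 * r * Z"
    and card_V: "card V = n * N * k"
    and R_big: "5832 * (r - 1) \<le> R"
    and D_eq: "D = 4 * k ^ (r - 1) * G"
    and k_eq: "k = 120 * r * G"
    and G_big: "2916 \<le> G"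
    and r_ge: "2 \<le> r"
begin

lemma k_big: "2916 \<le> k"
proof -
  have "1 * G \<le> (120 * r) * G" using r_pos by (intro mult_le_mono1) simp
  then have "G \<le> k" unfolding k_eq by simp
  then show ?thesis using G_big by linarith
qed

lemma N_pos: "0 < N" using q_pos[of 0] q_0 by simp

text \<open>Each special step at level \<open>j\<close> uses up \<open>b j\<close> lines of level
  \<open>Suc j\<close>; \<open>b_step\<close> makes the supply from \<open>num_bound\<close> worth
  exactly \<open>Z\<close> such steps. At the last level the hypothesis on full lines is the
  supply.\<close>

lemma special_few:
  assumes "num xs r \<le> Z" "j < r"
  shows "num_special j xs \<le> Z"
proof (cases "Suc j < r")
  case True
  have "(b j * q (Suc j)) * num_special j xs = q (Suc j) * (b j * num_special j xs)"
    by simp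
  also have "\<dots> \<le> q (Suc j) * num xs (Suc j)" by (intro mult_le_mono2 special_bound)
  also have "\<dots> \<le> 4 * b (Suc j) * card V" using num_bound[OF True] a_eq by simp
  also have "\<dots> = (b j * q (Suc j)) * Z"
    unfolding b_step[OF True] card_V n_eq by simp
  finally show ?thesis using b_pos q_pos by simp
next
  case False
  then have "j = r - 1" "Suc j = r" using assms by auto
  then show ?thesis using special_bound[of j xs] b_last assms by simp
qed

text \<open>In \<open>ordinary_cover\<close>, stuck vertices account for at most
  \<open>1 / 1458\<close> of \<open>V\<close>, and old vertices and full lines for at most
  \<open>1 / 2916\<close> each, which adds up to \<open>1 / 729\<close>.\<close>

lemma ordinary_few:
  assumes "length xs \<le> n" "num xs r \<le> Z"
  shows "729 * card {v\<in>V. \<not> (\<exists>j<r. special xs j v)} \<le> card V"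
proof -
  have st: "R * card (stuck xs j) \<le> 4 * card V" if "j < r - 1" for j
  proof -
    have j: "Suc j < r" using that by simp
    have "(b j * q (Suc j)) * (R * card (stuck xs j)) = q j * (b j * card (stuck xs j))"
      by (simp add: q_step[OF j])
    also have "\<dots> \<le> q j * (q (Suc j) * num xs j)" by (intro mult_le_mono2 stuck_bound[OF j])
    also have "\<dots> = q (Suc j) * (q j * num xs j)" by simp
    also have "\<dots> \<le> q (Suc j) * (a j * card V)" using j by (intro mult_le_mono2 num_bound) simp
    also have "\<dots> = (b j * q (Suc j)) * (4 * card V)" by (simp add: a_eq)
    finally show ?thesis using b_pos q_pos by simp
  qed
  have "R * (1458 * (\<Sum>j<r-1. card (stuck xs j))) = 1458 * (\<Sum>j<r-1. R * card (stuck xs j))"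
    by (simp only: mult.left_commute[of R 1458] sum_distrib_left)
  also have "\<dots> \<le> 1458 * (\<Sum>j<r-1. 4 * card V)"
    using st by (intro mult_le_mono2 sum_mono) simp
  also have "\<dots> = 5832 * (r - 1) * card V" by simp
  also have "\<dots> \<le> R * card V" using R_big by (rule mult_le_mono1)
  finally have "R * (1458 * (\<Sum>j<r-1. card (stuck xs j))) \<le> R * card V" .
  moreover have "0 < R" using R_big r_ge by (cases R) auto
  ultimately have 1: "1458 * (\<Sum>j<r-1. card (stuck xs j)) \<le> card V" by simp
  have "1 * 2916 \<le> N * k" using k_big N_pos by (intro mult_le_mono) auto
  then have "(1 * 2916) * length xs \<le> (N * k) * n" using assms(1) by (rule mult_le_mono)
  then have 2: "2916 * length xs \<le> card V" by (simp add: card_V mult.commute mult.left_commute)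
  have "2916 * (N * num xs r) \<le> k * (N * Z)"
    using k_big assms(2) by (intro mult_le_mono) auto
  also have "\<dots> \<le> (5 * r) * (k * (N * Z))" using r_pos by simp
  also have "\<dots> = card V" unfolding card_V n_eq by simp
  finally have 3: "2916 * (N * num xs r) \<le> card V" .
  show ?thesis using card_ordinary[of xs] 1 2 3 by linarith
qed

definition bad :: "'v list \<Rightarrow> bool" where
  "bad ys \<longleftrightarrow> (\<exists>S\<subseteq>{..<n}. 2 * r * Z \<le> card S \<and> num (sub ys S) r \<le> Z)"

lemma card_bad:
  "3 ^ (r * Z) * card {ys. set ys \<subseteq> V \<and> length ys = n \<and> bad ys} \<le> card V ^ n"
proof -
  define f where "f = card V div 729"
  let ?W = "{zs. set zs \<subseteq> V \<times> (UNIV::bool set) \<and> length zs = n}"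
  let ?B = "{zs\<in>?W. 2 * r * Z \<le> length (mask zs) \<and> num (mask zs) r \<le> Z}"
  have finW: "finite ?W" using finV by (intro finite_lists_length_eq) simp
  \<comment> \<open>Marking a witness \<open>S\<close> inside the list turns every bad sample into a
    projection of a marked list, so marked lists can be counted instead.\<close>
  have sub: "{ys. set ys \<subseteq> V \<and> length ys = n \<and> bad ys} \<subseteq> map fst ` ?B"
  proof
    fix ys assume "ys \<in> {ys. set ys \<subseteq> V \<and> length ys = n \<and> bad ys}"
    then obtain S where ys: "set ys \<subseteq> V" "length ys = n" and
      S: "S \<subseteq> {..<n}" "2 * r * Z \<le> card S" "num (sub ys S) r \<le> Z" by (auto simp: bad_def)
    let ?zs = "map (\<lambda>t. (ys ! t, t \<in> S)) [0..<length ys]"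
    have "ys = map fst ?zs" by (simp add: comp_def map_nth)
    moreover have "?zs \<in> ?B"
      using ys S length_sub[of S ys] by (auto simp: sub_eq_mask[symmetric])
    ultimately show "ys \<in> map fst ` ?B" by (rule image_eqI)
  qed
  have "card {ys. set ys \<subseteq> V \<and> length ys = n \<and> bad ys} \<le> card ?B"
    by (rule surj_card_le[OF _ sub]) (rule finite_subset[OF _ finW], blast)
  then have "3 ^ (r * Z) * card {ys. set ys \<subseteq> V \<and> length ys = n \<and> bad ys} * 3 ^ n \<le> 3 ^ (r * Z) * 3 ^ n * card ?B"
    by simp
  also have "3 ^ (r * Z) * 3 ^ n = (729::nat) ^ (r * Z)"
  proof -
    have "(729::nat) ^ (r * Z) = (3 ^ 6) ^ (r * Z)" by simp
    also have "\<dots> = 3 ^ (6 * (r * Z))" by (rule power_mult[symmetric])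
    also have "6 * (r * Z) = r * Z + n" by (simp add: n_eq)
    finally show ?thesis by (simp only: power_add)
  qed
  also have "729 ^ (r * Z) * card ?B = (\<Sum>zs\<in>?B. 729 ^ (r * Z))" by simp
  also have "\<dots> \<le> (\<Sum>zs\<in>?B. if num (mask zs) r \<le> Z then 729 ^ num_ordinary (mask zs) else 0)"
  proof (rule sum_mono)
    fix zs assume zs: "zs \<in> ?B"
    have "(\<Sum>j<r. num_special j (mask zs)) \<le> (\<Sum>j<r. Z)"
      using zs by (intro sum_mono special_few) auto
    then have "r * Z \<le> num_ordinary (mask zs)"
      using zs length_le[of "mask zs"] by simp
    then show "729 ^ (r * Z) \<le> (if num (mask zs) r \<le> Z then 729 ^ num_ordinary (mask zs) else (0::nat))"
      using zs by (auto intro: power_increasing)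
  qed
  also have "\<dots> \<le> (\<Sum>zs\<in>?W. if num (mask zs) r \<le> Z then 729 ^ num_ordinary (mask zs) else 0)"
    using finW by (intro sum_mono2) auto
  also have "\<dots> \<le> (2 * card V + 729 * f) ^ n"
  proof (rule ordinary_moment)
    fix xs :: "'v list" assume "length xs \<le> n" "num xs r \<le> Z"
    from ordinary_few[OF this] show "card {v\<in>V. \<not> (\<exists>j<r. special xs j v)} \<le> f"
      unfolding f_def by linarith
  qed simp
  also have "\<dots> \<le> (3 * card V) ^ n" unfolding f_def by (intro power_mono) auto
  also have "\<dots> = card V ^ n * 3 ^ n" by (simp add: power_mult_distrib)
  finally show ?thesis by simp
qed

text \<open>A binomial moment bounding the number of lines with at least \<open>s\<close> sample
  positions, with an expectation available from \<open>sum_choose_filter\<close>.\<close>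

definition rich :: "nat \<Rightarrow> 'v list \<Rightarrow> nat" where
  "rich s ys = (\<Sum>L\<in>Ls. length (filter (\<lambda>y. y \<in> L) ys) choose s)"

lemma V_pos: "0 < card V"
  using k_big N_pos Z_pos r_pos by (simp add: card_V n_eq)

text \<open>There are \<open>D * n * k\<close> lines, and each has expected binomial moment at most
  \<open>k ^ (-(s + 1))\<close>, because \<open>n * N = card V / k\<close>. One factor
  \<open>k\<close> cancels.\<close>

lemma sum_rich:
  "k ^ s * (\<Sum>ys | set ys \<subseteq> V \<and> length ys = n. rich (Suc s) ys) \<le> D * n * card V ^ n"
proof -
  let ?U = "{ys. set ys \<subseteq> V \<and> length ys = n}"
  let ?c = "\<lambda>L ys. length (filter (\<lambda>y. y \<in> L) ys) choose Suc s"
  have cLs: "card Ls = D * n * k"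
  proof -
    have "card Ls * N = D * n * k * N" using card_Ls by (simp add: card_V mult.assoc)
    then show ?thesis using N_pos by (simp add: mult.assoc)
  qed
  let ?S = "\<Sum>ys\<in>?U. rich (Suc s) ys"
  have "?S = (\<Sum>L\<in>Ls. \<Sum>ys\<in>?U. ?c L ys)"
    unfolding rich_def by (rule sum.swap)
  then have "?S * card V ^ Suc s = (\<Sum>L\<in>Ls. (\<Sum>ys\<in>?U. ?c L ys) * card V ^ Suc s)"
    by (simp only: sum_distrib_right)
  also have "\<dots> = (\<Sum>L\<in>Ls. (n choose Suc s) * N ^ Suc s * card V ^ n)"
  proof (intro sum.cong refl)
    fix L assume L: "L \<in> Ls"
    show "(\<Sum>ys\<in>?U. ?c L ys) * card V ^ Suc s = (n choose Suc s) * N ^ Suc s * card V ^ n"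
      using sum_choose_filter[OF finV Ls_sub[OF L], of "Suc s" n] unfolding card_line[OF L] .
  qed
  also have "\<dots> \<le> (\<Sum>L\<in>Ls. n ^ Suc s * N ^ Suc s * card V ^ n)"
    by (intro sum_mono mult_le_mono1) (metis binomial_le_pow binomial_eq_0 le0 not_le)
  finally have "k ^ Suc s * (?S * card V ^ Suc s) \<le> k ^ Suc s * (\<Sum>L\<in>Ls. n ^ Suc s * N ^ Suc s * card V ^ n)"
    by (rule mult_le_mono2)
  also have "\<dots> = card Ls * (n * N * k) ^ Suc s * card V ^ n"
    by (simp add: power_mult_distrib)
  also have "\<dots> = card V ^ Suc s * (k * (D * n * card V ^ n))"
    by (simp only: card_V[symmetric] cLs) simp
  finally have "card V ^ Suc s * (k ^ Suc s * ?S) \<le> card V ^ Suc s * (k * (D * n * card V ^ n))"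
    by (simp only: mult_ac)
  then have "k * (k ^ s * (\<Sum>ys\<in>?U. rich (Suc s) ys)) \<le> k * (D * n * card V ^ n)"
    using V_pos by (simp add: mult.assoc)
  then show ?thesis using k_big by simp
qed

text \<open>The means of \<open>rich r\<close> and \<open>k * rich (Suc r)\<close> are at most
  \<open>4 * G * n\<close>, and \<open>12 * G * n\<close> is three times that. By Markov's
  inequality the exceptional sets have proportions at most 1/3, 1/3 and 1/4, less than 1 in
  total.\<close>

lemma good_sample:
  obtains ys where "set ys \<subseteq> V" "length ys = n" "rich r ys \<le> 12 * G * n"
    "k * rich (Suc r) ys \<le> 12 * G * n" "\<not> bad ys"
proof -
  let ?U = "{ys. set ys \<subseteq> V \<and> length ys = n}"
  have finU: "finite ?U" using finV by (rule finite_lists_length_eq)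
  have cU: "card ?U = card V ^ n" using finV by (rule card_lists_length_eq)
  have c: "0 < 12 * G * n" using G_big Z_pos r_pos n_eq by simp
  have kp: "0 < k" using k_big by simp
  have "k ^ (r - 1) * (\<Sum>ys\<in>?U. rich r ys) \<le> k ^ (r - 1) * (4 * G * n * card V ^ n)"
    using sum_rich[of "r - 1"] r_pos by (simp add: D_eq mult.assoc)
  then have "3 * sum (rich r) ?U \<le> 12 * G * n * card ?U"
    unfolding cU using kp by simp
  then have 1: "3 * card {ys\<in>?U. 12 * G * n < rich r ys} \<le> card ?U"
    using markov_card[OF finU _ c] by blast
  have "k ^ r = k ^ (r - 1) * k" using r_pos by (metis Suc_pred' power_Suc2)
  then have "k ^ (r - 1) * (k * (\<Sum>ys\<in>?U. rich (Suc r) ys)) \<le> k ^ (r - 1) * (4 * G * n * card V ^ n)"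
    using sum_rich[of r] by (simp add: D_eq mult.assoc)
  then have "k * (\<Sum>ys\<in>?U. rich (Suc r) ys) \<le> 4 * G * n * card V ^ n"
    using kp by simp
  moreover have "(\<Sum>ys\<in>?U. k * rich (Suc r) ys) = k * (\<Sum>ys\<in>?U. rich (Suc r) ys)"
    by (rule sum_distrib_left[symmetric])
  ultimately have "3 * (\<Sum>ys\<in>?U. k * rich (Suc r) ys) \<le> 12 * G * n * card ?U"
    unfolding cU by simp
  then have 2: "3 * card {ys\<in>?U. 12 * G * n < k * rich (Suc r) ys} \<le> card ?U"
    using markov_card[OF finU _ c] by blast
  have "4 \<le> (3::nat) ^ 2" by simp
  also have "\<dots> \<le> 3 ^ (r * Z)" using r_ge Z_pos by (intro power_increasing) (auto simp: le_trans[OF r_ge])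
  finally have "4 * card {ys\<in>?U. bad ys} \<le> 3 ^ (r * Z) * card {ys\<in>?U. bad ys}" by (rule mult_le_mono1)
  also have "\<dots> \<le> card ?U" using card_bad by (simp add: cU conj_assoc)
  finally have 3: "4 * card {ys\<in>?U. bad ys} \<le> card ?U" .
  have "card ({ys\<in>?U. 12 * G * n < rich r ys} \<union> {ys\<in>?U. 12 * G * n < k * rich (Suc r) ys} \<union> {ys\<in>?U. bad ys})
      \<le> card {ys\<in>?U. 12 * G * n < rich r ys} + card {ys\<in>?U. 12 * G * n < k * rich (Suc r) ys}
        + card {ys\<in>?U. bad ys}"
    by (meson add_le_mono1 card_Un_le le_trans)
  moreover have "0 < card ?U" using V_pos cU by simp
  ultimately have "card ({ys\<in>?U. 12 * G * n < rich r ys} \<union> {ys\<in>?U. 12 * G * n < k * rich (Suc r) ys}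
      \<union> {ys\<in>?U. bad ys}) < card ?U" (is "card ?X < _")
    using 1 2 3 by linarith
  moreover have "card ?U \<le> card ?X" if "?U \<subseteq> ?X"
    by (rule card_mono[OF _ that]) (rule finite_subset[OF _ finU], blast)
  ultimately have "\<not> ?U \<subseteq> ?X" by linarith
  then obtain ys where "ys \<in> ?U" "ys \<notin> ?X" by blast
  then show thesis using that[of ys] by (auto simp: not_less)
qed

end

section \<open>Greedy selection of few lines\<close>

text \<open>By averaging, some \<open>e\<close> hits at least a \<open>1 / k\<close> share of the
  sets still missed, so each choice shrinks them by the factor \<open>(k - 1) / k\<close>. The
  assumption \<open>ne\<close> excludes an empty \<open>E\<close>, for which \<open>dense\<close>
  holds vacuously.\<close>

lemma greedy_hitting:
  fixes Q :: "'a \<Rightarrow> 'b \<Rightarrow> bool"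
  assumes fin: "finite E" "finite F"
    and dense: "\<And>S. S \<in> F \<Longrightarrow> card E \<le> k * card {e\<in>E. Q e S}"
    and ne: "\<And>S. S \<in> F \<Longrightarrow> \<exists>e\<in>E. Q e S"
  shows "\<exists>E'\<subseteq>E. card E' \<le> t \<and> card {S\<in>F. \<forall>e\<in>E'. \<not> Q e S} * k ^ t \<le> (k - 1) ^ t * card F"
proof (induction t)
  case 0
  show ?case by (intro exI[of _ "{}"]) simp
next
  case (Suc t)
  then obtain E' where E': "E' \<subseteq> E" "card E' \<le> t"
    "card {S\<in>F. \<forall>e\<in>E'. \<not> Q e S} * k ^ t \<le> (k - 1) ^ t * card F" by blast
  let ?U = "{S\<in>F. \<forall>e\<in>E'. \<not> Q e S}"
  have finU: "finite ?U" using fin by simp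
  show ?case
  proof (cases "?U = {}")
    case True
    have "card ?U * k ^ Suc t \<le> (k - 1) ^ Suc t * card F" unfolding True by simp
    then show ?thesis using E' by (intro exI[of _ E']) simp
  next
    case False
    then have "E \<noteq> {}" using ne by blast
    have "card ?U * card E = (\<Sum>S\<in>?U. card E)" by simp
    also have "\<dots> \<le> (\<Sum>S\<in>?U. k * card {e\<in>E. Q e S})"
      by (intro sum_mono dense) simp
    also have "\<dots> = k * (\<Sum>e\<in>E. card {S\<in>?U. Q e S})"
      using sum_card_swap[OF finU fin(1), of "\<lambda>S e. Q e S"] by (simp only: sum_distrib_left[symmetric])
    finally have avg: "card ?U * card E \<le> k * (\<Sum>e\<in>E. card {S\<in>?U. Q e S})" .
    have "\<exists>e\<in>E. card ?U \<le> k * card {S\<in>?U. Q e S}"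
    proof (rule ccontr)
      assume "\<not> ?thesis"
      then have "(\<Sum>e\<in>E. k * card {S\<in>?U. Q e S}) < (\<Sum>e\<in>E. card ?U)"
        using fin(1) \<open>E \<noteq> {}\<close> by (intro sum_strict_mono) (auto simp: not_le)
      then show False using avg by (simp add: sum_distrib_left mult.commute)
    qed
    then obtain e where e: "e \<in> E" "card ?U \<le> k * card {S\<in>?U. Q e S}" by blast
    let ?U' = "{S\<in>F. \<forall>e'\<in>insert e E'. \<not> Q e' S}"
    have "?U = {S\<in>?U. Q e S} \<union> ?U'" by blast
    moreover have "{S\<in>?U. Q e S} \<inter> ?U' = {}" by blast
    ultimately have "card ?U = card {S\<in>?U. Q e S} + card ?U'"
      using fin(2) by (metis (no_types, lifting) card_Un_disjoint finite_Un finU)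
    then have "k * card ?U = k * card {S\<in>?U. Q e S} + k * card ?U'" by (simp add: distrib_left)
    then have "k * card ?U' \<le> k * card ?U - card ?U" using e(2) by linarith
    also have "\<dots> = (k - 1) * card ?U" by (simp add: diff_mult_distrib)
    finally have "(k * card ?U') * k ^ t \<le> ((k - 1) * card ?U) * k ^ t" by (rule mult_le_mono1)
    then have "card ?U' * k ^ Suc t \<le> (k - 1) * (card ?U * k ^ t)" by (simp add: mult_ac)
    also have "\<dots> \<le> (k - 1) * ((k - 1) ^ t * card F)" using E'(3) by (rule mult_le_mono2)
    finally have "card ?U' * k ^ Suc t \<le> (k - 1) ^ Suc t * card F" by simp
    moreover have "card (insert e E') \<le> Suc t"
      using E'(2) finite_subset[OF E'(1) fin(1)] by (simp add: card_insert_if)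
    ultimately show ?thesis using e(1) E'(1) by (intro exI[of _ "insert e E'"]) blast
  qed
qed

text \<open>Bernoulli's inequality for \<open>k / (k - 1) = 1 + 1 / m\<close>. The factor 2 is there
  to beat the up to \<open>2 ^ n\<close> parts that must be hit.\<close>

lemma two_mult_pred_power_less:
  fixes k :: nat
  assumes "2 \<le> k"
  shows "2 * (k - 1) ^ k < k ^ k"
proof -
  define m where "m = real (k - 1)"
  have m: "1 \<le> m" "real k = m + 1" using assms by (auto simp: m_def)
  have "1 + real k * (1 / m) \<le> (1 + 1 / m) ^ k" using m by (intro Bernoulli_inequality) (simp add: field_simps)
  moreover have "2 < 1 + real k * (1 / m)" using m by (simp add: field_simps)
  ultimately have "2 < (1 + 1 / m) ^ k" by linarith
  then have "2 * m ^ k < (1 + 1 / m) ^ k * m ^ k" using m by (intro mult_strict_right_mono) auto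
  also have "\<dots> = ((1 + 1 / m) * m) ^ k" by (simp add: power_mult_distrib)
  also have "(1 + 1 / m) * m = real k" using m by (simp add: field_simps)
  finally have "real (2 * (k - 1) ^ k) < real (k ^ k)" by (simp add: m_def)
  then show ?thesis by (simp only: of_nat_less_iff)
qed

section \<open>The unsplittable configuration in the hypergraph\<close>

context sampling
begin

text \<open>More than \<open>Z\<close> lines become full inside \<open>S\<close>, and at most
  \<open>Z / 2\<close> lines receive more than \<open>r\<close> positions. A full line of the
  remaining kind has all its \<open>r\<close> positions in \<open>S\<close>, carrying distinct
  vertices. So more than \<open>Z / 2\<close> lines of \<open>E\<close> lie in \<open>S\<close>,
  against at most \<open>60 * r * G * Z = k * Z / 2\<close> in all.\<close>

lemma dense_exact_lines:
  assumes ys: "set ys \<subseteq> V" "length ys = n" "rich r ys \<le> 12 * G * n"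
    "k * rich (Suc r) ys \<le> 12 * G * n" "\<not> bad ys"
    and e_def: "e = (\<lambda>L. {t. t < n \<and> ys ! t \<in> L})"
    and E_def: "E = {L\<in>Ls. card (e L) = r \<and> inj_on ((!) ys) (e L)}"
    and S: "S \<subseteq> {..<n}" "2 * r * Z \<le> card S"
  shows "card E \<le> k * card {L\<in>E. e L \<subseteq> S}" "\<exists>L\<in>E. e L \<subseteq> S"
proof -
  have fine: "finite (e L)" for L by (simp add: e_def)
  have choose: "length (filter (\<lambda>y. y \<in> L) ys) = card (e L)" for L
    using ys(2) by (simp add: length_filter_conv_card e_def)
  have "card E = (\<Sum>L\<in>E. 1)" by simp
  also have "\<dots> \<le> (\<Sum>L\<in>Ls. card (e L) choose r)"
    unfolding E_def using finLs by (intro sum_le_included[where i = id]) auto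
  finally have E_le: "card E \<le> 12 * G * n" using ys(3) by (simp add: rich_def choose)
  let ?T = "{L\<in>Ls. r < card (e L)}"
  have "card ?T = (\<Sum>L\<in>?T. 1)" by simp
  also have "\<dots> \<le> (\<Sum>L\<in>?T. card (e L) choose Suc r)"
    by (intro sum_mono) (simp add: Suc_le_eq)
  also have "\<dots> \<le> (\<Sum>L\<in>Ls. card (e L) choose Suc r)"
    using finLs by (intro sum_mono2) auto
  finally have "k * card ?T \<le> 12 * G * n"
    using ys(4) by (simp add: rich_def choose) (meson le_trans mult_le_mono2)
  then have "(60 * r * G) * (2 * card ?T) \<le> (60 * r * G) * Z"
    by (simp add: k_eq n_eq mult_ac)
  then have T_le: "2 * card ?T \<le> Z" using r_pos G_big by simp
  let ?H = "{L\<in>Ls. r \<le> lev (sub ys S) L}"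
  have H: "Z < card ?H" using ys(5) S by (auto simp: bad_def num_def not_le)
  have "?H \<subseteq> {L\<in>E. e L \<subseteq> S} \<union> ?T"
  proof
    fix L assume "L \<in> ?H"
    then have L: "L \<in> Ls" "r \<le> card (L \<inter> set (sub ys S))" using lev_le_card[of L "sub ys S"] by auto
    have "L \<inter> set (sub ys S) \<subseteq> (!) ys ` (e L \<inter> S)"
      using S(1) ys(2) by (auto simp: set_sub e_def)
    then have 1: "r \<le> card ((!) ys ` (e L \<inter> S))"
      using L(2) fine by (meson card_mono finite_Int finite_imageI le_trans)
    also have 2: "card ((!) ys ` (e L \<inter> S)) \<le> card (e L \<inter> S)"
      using fine by (intro card_image_le) simp
    finally have 3: "r \<le> card (e L \<inter> S)" .
    have 4: "card (e L \<inter> S) \<le> card (e L)" using fine by (intro card_mono) auto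
    show "L \<in> {L\<in>E. e L \<subseteq> S} \<union> ?T"
    proof (cases "r < card (e L)")
      case True
      then show ?thesis using L by simp
    next
      case False
      then have c: "card (e L \<inter> S) = card (e L)" "card (e L) = r" using 3 4 by auto
      then have sub: "e L \<inter> S = e L" using fine by (metis card_subset_eq inf_le1)
      then have "inj_on ((!) ys) (e L)" using 1 2 c fine by (intro eq_card_imp_inj_on) auto
      then show ?thesis using L c sub by (auto simp: E_def)
    qed
  qed
  moreover have finE: "finite E" using finLs by (simp add: E_def)
  ultimately have "card ?H \<le> card {L\<in>E. e L \<subseteq> S} + card ?T"
    using finLs by (intro order_trans[OF card_mono card_Un_le]) auto
  then have big: "Z < 2 * card {L\<in>E. e L \<subseteq> S}" using H T_le by linarith
  have "card E \<le> (60 * r * G) * Z" using E_le by (simp add: n_eq mult_ac)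
  also have "\<dots> \<le> (60 * r * G) * (2 * card {L\<in>E. e L \<subseteq> S})"
    using big by (intro mult_le_mono2) simp
  finally show "card E \<le> k * card {L\<in>E. e L \<subseteq> S}" by (simp add: k_eq mult_ac)
  show "\<exists>L\<in>E. e L \<subseteq> S"
  proof (rule ccontr)
    assume "\<not> ?thesis"
    then have "{L\<in>E. e L \<subseteq> S} = {}" by blast
    then show False using big by (simp only: card.empty)
  qed
qed

lemma unsplittable_configuration:
  "\<exists>Ls'\<subseteq>Ls. \<exists>P\<subseteq>V. (\<forall>L\<in>Ls'. card (L \<inter> P) = r) \<and>
     (\<forall>p\<in>P. card {p'\<in>P. p' \<noteq> p \<and> (\<exists>L\<in>Ls'. p \<in> L \<and> p' \<in> L)} \<le> 5 * r * k * (r - 1)) \<and>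
     \<not> (\<exists>P1 P2. P1 \<union> P2 = P \<and> P1 \<inter> P2 = {} \<and> (\<forall>L\<in>Ls'. (\<exists>x\<in>P1. x \<in> L) \<and> (\<exists>y\<in>P2. y \<in> L)))"
proof -
  obtain ys where ys: "set ys \<subseteq> V" "length ys = n" "rich r ys \<le> 12 * G * n"
    "k * rich (Suc r) ys \<le> 12 * G * n" "\<not> bad ys" by (rule good_sample)
  define e where "e = (\<lambda>L. {t. t < n \<and> ys ! t \<in> L})"
  define E where "E = {L\<in>Ls. card (e L) = r \<and> inj_on ((!) ys) (e L)}"
  define F where "F = {S. S \<subseteq> {..<n} \<and> 2 * r * Z \<le> card S}"
  have finE: "finite E" using finLs by (simp add: E_def)
  have FPow: "F \<subseteq> Pow {..<n}" by (auto simp: F_def)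
  then have finF: "finite F" by (rule finite_subset) simp
  have cF: "card F \<le> 2 ^ n" using card_mono[OF _ FPow] by (simp add: card_Pow)
  have "\<exists>E'\<subseteq>E. card E' \<le> k * n \<and>
      card {S\<in>F. \<forall>L\<in>E'. \<not> e L \<subseteq> S} * k ^ (k * n) \<le> (k - 1) ^ (k * n) * card F"
    using finE finF dense_exact_lines[OF ys e_def E_def]
    by (intro greedy_hitting) (simp_all add: F_def)
  then obtain E' where E': "E' \<subseteq> E" "card E' \<le> k * n"
    "card {S\<in>F. \<forall>L\<in>E'. \<not> e L \<subseteq> S} * k ^ (k * n) \<le> (k - 1) ^ (k * n) * card F" by blast
  have n_pos: "0 < n" using Z_pos r_pos by (simp add: n_eq)
  have hit: "\<exists>L\<in>E'. e L \<subseteq> S" if "S \<in> F" for S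
  \<comment> \<open>After \<open>k * n\<close> greedy choices fewer than one set is left unhit:
    \<open>(2 * (k - 1) ^ k) ^ n < (k ^ k) ^ n\<close>.\<close>
  proof (rule ccontr)
    assume "\<not> ?thesis"
    then have "S \<in> {S\<in>F. \<forall>L\<in>E'. \<not> e L \<subseteq> S}" using that by blast
    then have "1 \<le> card {S\<in>F. \<forall>L\<in>E'. \<not> e L \<subseteq> S}"
      using finF by (metis (no_types, lifting) One_nat_def Suc_leI card_gt_0_iff empty_iff finite_Collect_conjI finite_subset mem_Collect_eq subsetI)
    then have "k ^ (k * n) \<le> (k - 1) ^ (k * n) * card F"
      using E'(3) by (metis (no_types, lifting) le_trans mult_le_mono1 nat_mult_1)
    also have "\<dots> \<le> (k - 1) ^ (k * n) * 2 ^ n" using cF by (rule mult_le_mono2)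
    also have "\<dots> = (2 * (k - 1) ^ k) ^ n" by (simp add: power_mult power_mult_distrib)
    also have "\<dots> < (k ^ k) ^ n"
      using two_mult_pred_power_less[of k] k_big n_pos by (intro power_strict_mono) auto
    finally show False by (simp add: power_mult)
  qed
  have finE': "finite E'" using finE E'(1) by (rule rev_finite_subset)
  define deg where "deg = (\<lambda>t. card {L\<in>E'. ys ! t \<in> L})"
  \<comment> \<open>The average of \<open>deg\<close> is at most \<open>k * r\<close>. Exceeding it
    five times happens at fewer than \<open>n / 5 = r * Z\<close> positions.\<close>
  define Ov where "Ov = {t. t < n \<and> 5 * r * k < deg t}"
  have "(5 * r * k + 1) * card Ov = (\<Sum>t\<in>Ov. 5 * r * k + 1)" by simp
  also have "\<dots> \<le> (\<Sum>t\<in>Ov. deg t)" by (intro sum_mono) (simp add: Ov_def)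
  also have "\<dots> \<le> (\<Sum>t<n. deg t)" by (intro sum_mono2) (auto simp: Ov_def)
  also have "\<dots> = (\<Sum>L\<in>E'. card (e L))"
    unfolding deg_def e_def using sum_card_swap[of "{..<n}" E' "\<lambda>t L. ys ! t \<in> L"] finE' by simp
  also have "\<dots> = (\<Sum>L\<in>E'. r)" using E'(1) by (intro sum.cong) (auto simp: E_def)
  also have "\<dots> \<le> (k * n) * r" using E'(2) by simp
  finally have "(5 * r * k + 1) * card Ov \<le> (5 * r * k) * (r * Z)" by (simp add: n_eq mult_ac)
  moreover have "(5 * r * k) * (r * Z) < (5 * r * k + 1) * (r * Z)" using r_pos Z_pos by simp
  ultimately have Ov: "card Ov < r * Z" by (meson le_less_trans mult_less_cancel1)
  define Ls' where "Ls' = {L\<in>E'. e L \<inter> Ov = {}}"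
  define P where "P = (!) ys ` ({..<n} - Ov)"
  have LP: "L \<inter> P = (!) ys ` e L" if "L \<in> Ls'" for L
    using that by (auto simp: Ls'_def P_def e_def)
  have cLP: "card (L \<inter> P) = r" if "L \<in> Ls'" for L
    using that E'(1) LP[OF that] by (auto simp: Ls'_def E_def card_image)
  have finP: "finite P" by (simp add: P_def)
  have "card {p'\<in>P. p' \<noteq> p \<and> (\<exists>L\<in>Ls'. p \<in> L \<and> p' \<in> L)} \<le> 5 * r * k * (r - 1)"
    if pP: "p \<in> P" for p
  proof -
    obtain t where t: "t < n" "t \<notin> Ov" "p = ys ! t" using pP by (auto simp: P_def)
    let ?A = "{L\<in>Ls'. p \<in> L}"
    have finA: "finite ?A" using finE' by (simp add: Ls'_def)
    have "card ?A \<le> deg t" unfolding deg_def using finE' t by (intro card_mono) (auto simp: Ls'_def)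
    then have cA: "card ?A \<le> 5 * r * k" using t by (simp add: Ov_def)
    have "card {p'\<in>P. p' \<noteq> p \<and> (\<exists>L\<in>Ls'. p \<in> L \<and> p' \<in> L)} \<le> card (\<Union>L\<in>?A. (L \<inter> P) - {p})"
      using finA finP by (intro card_mono) auto
    also have "\<dots> \<le> (\<Sum>L\<in>?A. card ((L \<inter> P) - {p}))" using finA by (rule card_UN_le)
    also have "\<dots> = (\<Sum>L\<in>?A. r - 1)"
      using pP cLP finP by (intro sum.cong refl) (simp add: card_Diff_singleton)
    also have "\<dots> \<le> 5 * r * k * (r - 1)" using cA by simp
    finally show ?thesis .
  qed
  \<comment> \<open>The positions counted avoid \<open>Ov\<close>, so a line of \<open>E'\<close>
    found inside them automatically survives in \<open>Ls'\<close>.\<close>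
  moreover have mono: "\<exists>L\<in>Ls'. L \<inter> P \<subseteq> Q"
    if "2 * r * Z \<le> card {t\<in>{..<n} - Ov. ys ! t \<in> Q}" for Q
  proof -
    let ?S = "{t\<in>{..<n} - Ov. ys ! t \<in> Q}"
    have "?S \<in> F" using that by (auto simp: F_def)
    then obtain L where L: "L \<in> E'" "e L \<subseteq> ?S" using hit by blast
    then have L': "L \<in> Ls'" by (auto simp: Ls'_def)
    have "L \<inter> P \<subseteq> Q" unfolding LP[OF L'] using L(2) by auto
    then show ?thesis using L' by (rule bexI)
  qed
  have "\<not> (\<exists>P1 P2. P1 \<union> P2 = P \<and> P1 \<inter> P2 = {} \<and> (\<forall>L\<in>Ls'. (\<exists>x\<in>P1. x \<in> L) \<and> (\<exists>y\<in>P2. y \<in> L)))"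
  proof
    assume "\<exists>P1 P2. P1 \<union> P2 = P \<and> P1 \<inter> P2 = {} \<and> (\<forall>L\<in>Ls'. (\<exists>x\<in>P1. x \<in> L) \<and> (\<exists>y\<in>P2. y \<in> L))"
    then obtain P1 P2 where P12: "P1 \<union> P2 = P" "P1 \<inter> P2 = {}"
      and cov: "\<forall>L\<in>Ls'. (\<exists>x\<in>P1. x \<in> L) \<and> (\<exists>y\<in>P2. y \<in> L)" by (elim exE conjE)
    let ?S = "\<lambda>Q. {t\<in>{..<n} - Ov. ys ! t \<in> Q}"
    \<comment> \<open>More than \<open>4 * r * Z\<close> positions remain, so one of the two classes
      holds at least \<open>2 * r * Z\<close> of them.\<close>
    have "{..<n} - Ov \<subseteq> ?S P1 \<union> ?S P2" using P12(1) by (auto simp: P_def)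
    then have "card ({..<n} - Ov) \<le> card (?S P1) + card (?S P2)"
      by (intro order_trans[OF card_mono card_Un_le]) auto
    moreover have "n - card Ov \<le> card ({..<n} - Ov)"
      using diff_card_le_card_Diff[of Ov "{..<n}"] by (simp add: Ov_def)
    moreover have "n = 5 * (r * Z)" "2 * r * Z = 2 * (r * Z)" by (simp_all add: n_eq)
    ultimately have "2 * r * Z \<le> card (?S P1) \<or> 2 * r * Z \<le> card (?S P2)"
      using Ov by linarith
    then have "(\<exists>L\<in>Ls'. L \<inter> P \<subseteq> P1) \<or> (\<exists>L\<in>Ls'. L \<inter> P \<subseteq> P2)" using mono[of P1] mono[of P2] by argo
    then obtain L where L: "L \<in> Ls'" "L \<inter> P \<subseteq> P1 \<or> L \<inter> P \<subseteq> P2" by blast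
    show False using bspec[OF cov L(1)] L(2) P12 by blast
  qed
  moreover have "Ls' \<subseteq> Ls" using E'(1) by (auto simp: Ls'_def E_def)
  moreover have "P \<subseteq> V" using ys(1,2) by (auto simp: P_def)
  ultimately show ?thesis using cLP by (intro exI[of _ Ls'] exI[of _ P] conjI ballI) simp_all
qed

end

section \<open>The grid, its axis lines and the generic projection\<close>

definition grid :: "nat \<Rightarrow> nat \<Rightarrow> (nat \<Rightarrow> nat) set" where
  "grid D N = {..<D} \<rightarrow>\<^sub>E {..<N}"

definition axis_line :: "nat \<Rightarrow> nat \<Rightarrow> nat \<Rightarrow> (nat \<Rightarrow> nat) \<Rightarrow> (nat \<Rightarrow> nat) set" where
  "axis_line D N i v = {w \<in> grid D N. \<forall>j. j \<noteq> i \<longrightarrow> w j = v j}"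

definition axis_lines :: "nat \<Rightarrow> nat \<Rightarrow> (nat \<Rightarrow> nat) set set" where
  "axis_lines D N = {axis_line D N i v | i v. i < D \<and> v \<in> grid D N}"

lemma finite_grid: "finite (grid D N)"
  by (simp add: grid_def finite_PiE)

lemma card_grid: "card (grid D N) = N ^ D"
  by (simp add: grid_def card_PiE)

lemma axis_line_eq_image:
  assumes "i < D" "v \<in> grid D N"
  shows "axis_line D N i v = (\<lambda>c. v(i := c)) ` {..<N}"
proof (intro equalityI subsetI)
  fix w assume w: "w \<in> axis_line D N i v"
  then have "w = v(i := w i)" by (auto simp: axis_line_def)
  moreover have "w i < N" using w assms by (auto simp: axis_line_def grid_def)
  ultimately show "w \<in> (\<lambda>c. v(i := c)) ` {..<N}" by blast
next
  fix w assume "w \<in> (\<lambda>c. v(i := c)) ` {..<N}"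
  then show "w \<in> axis_line D N i v"
    using assms by (auto simp: axis_line_def grid_def PiE_def extensional_def)
qed

lemma axis_line_cong: "w \<in> axis_line D N i v \<Longrightarrow> axis_line D N i v = axis_line D N i w"
  by (auto simp: axis_line_def)

text \<open>The embedding is \<open>v \<mapsto> (\<Sum>j. v j, \<Sum>j. v j * x ^ j)\<close>. A difference \<open>z\<close> of grid points is
  parallel to the image \<open>(1, x ^ i)\<close> of the \<open>i\<close>-th axis iff \<open>x\<close> is a root of
  \<open>\<Sum>j. z j * X ^ j - (\<Sum>j. z j) * X ^ i\<close>, so it suffices to avoid finitely many \<open>x\<close>.\<close>

lemma plane_embedding:
  "\<exists>(\<phi> :: (nat \<Rightarrow> nat) \<Rightarrow> real \<times> real) g. inj_on \<phi> (grid D N) \<and>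
    (\<forall>L\<in>axis_lines D N. is_line (g L) \<and> (\<forall>v\<in>grid D N. \<phi> v \<in> g L \<longleftrightarrow> v \<in> L))"
proof -
  define z :: "(nat \<Rightarrow> nat) \<Rightarrow> (nat \<Rightarrow> nat) \<Rightarrow> nat \<Rightarrow> real" where
    "z = (\<lambda>v w j. real (w j) - real (v j))"
  define p :: "(nat \<Rightarrow> nat) \<Rightarrow> (nat \<Rightarrow> nat) \<Rightarrow> nat \<Rightarrow> real poly" where
    "p = (\<lambda>v w i. (\<Sum>j<D. monom (z v w j) j) - monom (\<Sum>j<D. z v w j) i)"
  define Bad where "Bad = (\<Union>v\<in>grid D N. \<Union>w\<in>grid D N. \<Union>i\<in>{i. i < D \<and> p v w i \<noteq> 0}. {x. poly (p v w i) x = 0})"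
  have "finite Bad"
    unfolding Bad_def using finite_grid poly_roots_finite by (intro finite_UN_I) auto
  then obtain x where x: "x \<notin> Bad"
    using ex_new_if_finite[OF infinite_UNIV_char_0] by blast
  define \<phi> :: "(nat \<Rightarrow> nat) \<Rightarrow> real \<times> real" where
    "\<phi> = (\<lambda>v. (\<Sum>j<D. real (v j), \<Sum>j<D. real (v j) * x ^ j))"
  have diff: "fst (\<phi> w) - fst (\<phi> v) = (\<Sum>j<D. z v w j)"
    "snd (\<phi> w) - snd (\<phi> v) = (\<Sum>j<D. z v w j * x ^ j)" for v w
    by (simp_all add: \<phi>_def z_def sum_subtractf left_diff_distrib)
  have parallel: "w \<in> axis_line D N i v"
    if vw: "v \<in> grid D N" "w \<in> grid D N" "i < D"
      and eq: "snd (\<phi> w) - snd (\<phi> v) = (fst (\<phi> w) - fst (\<phi> v)) * x ^ i" for v w i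
  proof -
    have "poly (p v w i) x = 0"
      using eq by (simp add: p_def poly_sum poly_monom diff)
    then have "p v w i = 0" using x vw by (auto simp: Bad_def)
    \<comment> \<open>Only coefficients other than the \<open>i\<close>-th are compared: the
      subtracted monomial does not affect them, and coordinate \<open>i\<close> is free on the
      line.\<close>
    have "w j = v j" if "j \<noteq> i" for j
    proof (cases "j < D")
      case True
      have "coeff (p v w i) j = z v w j"
        using True that by (simp add: p_def coeff_sum)
      then show ?thesis using \<open>p v w i = 0\<close> by (simp add: z_def)
    next
      case False
      then show ?thesis using vw by (auto simp: grid_def PiE_def extensional_def)
    qed
    then show ?thesis using vw by (simp add: axis_line_def)
  qed
  have on_axis: "\<phi> w = \<phi> v + (real (w i) - real (v i)) *\<^sub>R (1, x ^ i)"
    if "i < D" "w \<in> axis_line D N i v" for v w i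
  proof -
    have *: "z v w j = 0" if "j \<noteq> i" for j
      using that \<open>w \<in> axis_line D N i v\<close> by (simp add: axis_line_def z_def)
    have "(\<Sum>j<D. z v w j) = (\<Sum>j\<in>{i}. z v w j)"
      using * that(1) by (intro sum.mono_neutral_right) auto
    moreover have "(\<Sum>j<D. z v w j * x ^ j) = (\<Sum>j\<in>{i}. z v w j * x ^ j)"
      using * that(1) by (intro sum.mono_neutral_right) auto
    ultimately show ?thesis
      using diff[of w v] by (simp add: prod_eq_iff z_def algebra_simps)
  qed
  have "inj_on \<phi> (grid D N)"
  proof (rule inj_onI)
    fix v w assume vw: "v \<in> grid D N" "w \<in> grid D N" "\<phi> v = \<phi> w"
    show "v = w"
    proof (cases "D = 0")
      case True
      then show ?thesis using vw by (auto simp: grid_def)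
    next
      case False
      \<comment> \<open>Equal images satisfy the slope condition trivially, so
        \<open>parallel\<close> applies with axis 0; along that axis the first coordinate of
        \<open>\<phi>\<close> separates points.\<close>
      then have w: "w \<in> axis_line D N 0 v" using vw by (intro parallel) auto
      then have "w 0 = v 0"
        using on_axis[OF _ w] False vw(3) by (simp add: prod_eq_iff)
      then show ?thesis using w by (intro ext) (metis (mono_tags, lifting) axis_line_def mem_Collect_eq)
    qed
  qed
  moreover have "\<exists>l. is_line l \<and> (\<forall>v\<in>grid D N. \<phi> v \<in> l \<longleftrightarrow> v \<in> L)" if "L \<in> axis_lines D N" for L
  proof -
    from that obtain i v where iv: "i < D" "v \<in> grid D N" "L = axis_line D N i v"
      by (auto simp: axis_lines_def)
    let ?l = "{\<phi> v + t *\<^sub>R (1, x ^ i) | t. True}"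
    have "is_line ?l" unfolding is_line_def by (intro exI[of _ "\<phi> v"] exI[of _ "(1, x ^ i)"]) simp
    moreover have "\<phi> w \<in> ?l \<longleftrightarrow> w \<in> L" if w: "w \<in> grid D N" for w
    proof
      assume "\<phi> w \<in> ?l"
      then obtain t where "\<phi> w = \<phi> v + t *\<^sub>R (1, x ^ i)" by blast
      then have "snd (\<phi> w) - snd (\<phi> v) = (fst (\<phi> w) - fst (\<phi> v)) * x ^ i" by simp
      then show "w \<in> L" using parallel iv w by simp
    next
      assume "w \<in> L"
      then show "\<phi> w \<in> ?l" using on_axis iv by blast
    qed
    ultimately show ?thesis by (intro exI[of _ ?l]) simp
  qed
  then have "\<exists>g. \<forall>L\<in>axis_lines D N. is_line (g L) \<and> (\<forall>v\<in>grid D N. \<phi> v \<in> g L \<longleftrightarrow> v \<in> L)"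
    by (intro bchoice ballI)
  ultimately show ?thesis by blast
qed

lemma linear_hypergraph_grid:
  assumes "2 \<le> N"
  shows "linear_hypergraph (grid D N) (axis_lines D N) N D"
proof
  show "finite (grid D N)" by (rule finite_grid)
next
  fix L assume "L \<in> axis_lines D N"
  then obtain i v where L: "i < D" "v \<in> grid D N" "L = axis_line D N i v"
    by (auto simp: axis_lines_def)
  show "L \<subseteq> grid D N" using L by (auto simp: axis_line_def)
  have "inj_on (\<lambda>c. v(i := c)) {..<N}" by (auto simp: inj_on_def fun_eq_iff split: if_splits)
  then show "card L = N" using L by (simp add: axis_line_eq_image card_image)
next
  fix v assume v: "v \<in> grid D N"
  have refl: "v \<in> axis_line D N i v" for i using v by (simp add: axis_line_def)
  have "{L \<in> axis_lines D N. v \<in> L} = (\<lambda>i. axis_line D N i v) ` {..<D}"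
  proof (intro equalityI subsetI)
    fix L assume "L \<in> {L \<in> axis_lines D N. v \<in> L}"
    then obtain i w where L: "i < D" "L = axis_line D N i w" "v \<in> axis_line D N i w"
      by (auto simp: axis_lines_def)
    then show "L \<in> (\<lambda>i. axis_line D N i v) ` {..<D}"
      using axis_line_cong[OF L(3)] by simp
  qed (use v refl in \<open>auto simp: axis_lines_def\<close>)
  moreover have "inj_on (\<lambda>i. axis_line D N i v) {..<D}"
  proof (rule inj_onI)
    fix i j assume ij: "i \<in> {..<D}" "j \<in> {..<D}" "axis_line D N i v = axis_line D N j v"
    \<comment> \<open>A second value of coordinate \<open>i\<close>, available because
      \<open>2 \<le> N\<close>, tells the lines through \<open>v\<close> in different directions
      apart.\<close>
    define c where "c = (if v i = 0 then 1 else 0 :: nat)"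
    have c: "c < N" "c \<noteq> v i" using assms by (auto simp: c_def)
    have "v(i := c) \<in> axis_line D N j v"
      using ij v c by (simp add: axis_line_eq_image flip: ij(3))
    then show "i = j" using c by (auto simp: axis_line_def split: if_splits)
  qed
  ultimately show "card {L \<in> axis_lines D N. v \<in> L} = D" by (simp add: card_image)
next
  fix L L' x y
  assume "L \<in> axis_lines D N" "L' \<in> axis_lines D N" and L: "L \<noteq> L'" "x \<in> L" "x \<in> L'" "y \<in> L" "y \<in> L'"
  then obtain i v j w where "L = axis_line D N i v" "L' = axis_line D N j w"
    by (auto simp: axis_lines_def)
  with L have eq: "L = axis_line D N i x" "L' = axis_line D N j x"
    using axis_line_cong by metis+
  then have "i \<noteq> j" using L by auto
  show "x = y"
  proof
    fix t
    show "x t = y t" using eq L \<open>i \<noteq> j\<close> by (cases "t = i") (auto simp: axis_line_def)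
  qed
qed

section \<open>Choice of the parameters\<close>

text \<open>Powers of \<open>r\<close> absorb the constants: \<open>20 \<le> r ^ 3\<close> and
  \<open>600 \<le> r ^ 6\<close>. With \<open>m = r - 1\<close> the exponent becomes
  \<open>9 * m * (m - 1) / 2 + 13 * m + 9\<close>, which stays below
  \<open>5 * (m + 1)\<^sup>2\<close> from \<open>m = 2\<close> on (44 against 45), but not at
  \<open>m = 1\<close>.\<close>

lemma degree_estimate:
  assumes r: "3 \<le> (r::nat)"
  shows "5 * r * (120 * r * (\<Prod>i<r-1. 20 * r * (r ^ 9) ^ Suc i)) * (r - 1) \<le> r ^ (5 * r\<^sup>2)"
proof -
  have r3: "(3::nat) ^ m \<le> r ^ m" for m using r by (rule power_mono) simp
  have exponent: "9 + (\<Sum>i<m. 9 * i + 13) \<le> 5 * (Suc m)\<^sup>2" if "2 \<le> m" for m :: nat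
    using that
  proof (induction m rule: dec_induct)
    case base
    show ?case by (simp add: numeral_2_eq_2)
  next
    case (step m)
    then show ?case by (simp add: power2_eq_square)
  qed
  have "(\<Prod>i<r-1. 20 * r * (r ^ 9) ^ Suc i) \<le> (\<Prod>i<r-1. r ^ (9 * i + 13))"
  proof (rule prod_mono, intro conjI)
    fix i
    have "20 * r * (r ^ 9) ^ Suc i \<le> r ^ 3 * r * (r ^ 9) ^ Suc i"
      using r3[of 3] by (intro mult_le_mono1) simp
    also have "\<dots> = r ^ (3 + 1 + 9 * Suc i)" by (simp only: power_add power_mult power_one_right)
    also have "3 + 1 + 9 * Suc i = 9 * i + 13" by simp
    finally show "20 * r * (r ^ 9) ^ Suc i \<le> r ^ (9 * i + 13)" .
  qed simp
  also have "\<dots> = r ^ (\<Sum>i<r-1. 9 * i + 13)" by (simp add: power_sum)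
  finally have G: "(\<Prod>i<r-1. 20 * r * (r ^ 9) ^ Suc i) \<le> r ^ (\<Sum>i<r-1. 9 * i + 13)" (is "?G \<le> ?X") .
  have "5 * r * (120 * r * ?G) * (r - 1) = (600 * r * r * (r - 1)) * ?G" by simp
  also have "\<dots> \<le> (r ^ 6 * r * r * r) * ?X"
    using r3[of 6] G by (intro mult_le_mono) auto
  also have "\<dots> = r ^ (9 + (\<Sum>i<r-1. 9 * i + 13))"
    by (simp add: power_add eval_nat_numeral)
  also have "\<dots> \<le> r ^ (5 * r\<^sup>2)"
    using exponent[of "r - 1"] r by (intro power_increasing) auto
  finally show ?thesis .
qed

lemma grid_configuration:
  assumes r: "3 \<le> r"
  shows "\<exists>D N. \<exists>Ls\<subseteq>axis_lines D N. \<exists>P\<subseteq>grid D N. (\<forall>L\<in>Ls. card (L \<inter> P) = r) \<and>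
     (\<forall>p\<in>P. card {p'\<in>P. p' \<noteq> p \<and> (\<exists>L\<in>Ls. p \<in> L \<and> p' \<in> L)} \<le> r ^ (5 * r\<^sup>2)) \<and>
     \<not> (\<exists>P1 P2. P1 \<union> P2 = P \<and> P1 \<inter> P2 = {} \<and> (\<forall>L\<in>Ls. (\<exists>x\<in>P1. x \<in> L) \<and> (\<exists>y\<in>P2. y \<in> L)))"
proof -
  \<comment> \<open>For \<open>3 \<le> r\<close> this is at least
    \<open>3 ^ 8 * r = 6561 * r\<close>, enough for \<open>R_big\<close>; for \<open>r = 2\<close>
    it would be too small.\<close>
  define R where "R = r ^ 9"
  define G where "G = (\<Prod>i<r-1. 20 * r * R ^ Suc i)"
  define k where "k = 120 * r * G"
  \<comment> \<open>This solves \<open>b_step\<close> backwards from \<open>b (r - 1) = 1\<close>,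
    where \<open>N\<close> divided by \<open>q (Suc j)\<close> is \<open>R ^ Suc j\<close>.\<close>
  define b where "b = (\<lambda>j. \<Prod>i=j..<r-1. 20 * k * r * R ^ Suc i)"
  \<comment> \<open>The ratio \<open>R\<close> is demanded by \<open>q_step\<close>. The factor
    \<open>5 * r * k\<close> lets one factor \<open>N\<close> of \<open>N ^ D\<close> supply
    \<open>5 * r * k\<close>, so that \<open>card_V\<close> holds exactly.\<close>
  define q where "q = (\<lambda>j. 5 * r * k * R ^ (r - j))"
  define D where "D = 4 * b 0"
  define N where "N = q 0"
  define Z where "Z = R ^ r * N ^ (D - 2)"
  have R_pos: "0 < R" using r by (simp add: R_def)
  have G_pos: "0 < G" using r R_pos by (simp add: G_def)
  have k_pos: "0 < k" using r G_pos by (simp add: k_def)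
  have b_pos: "0 < b j" for j using r R_pos k_pos by (simp add: b_def)
  have q_pos: "0 < q j" for j using r R_pos k_pos by (simp add: q_def)
  have b_rec: "b j = 20 * k * r * R ^ Suc j * b (Suc j)" if "Suc j < r" for j
    using that by (simp add: b_def prod.atLeast_Suc_lessThan)
  have R_ge: "6561 * r \<le> R"
  proof -
    have "(3::nat) ^ 8 * r \<le> r ^ 8 * r" using r by (intro mult_le_mono1 power_mono) auto
    then show ?thesis by (simp add: R_def power_Suc2[symmetric] del: power_Suc)
  qed
  have G_ge: "2916 \<le> G"
  proof -
    have "R \<le> 20 * r * R ^ Suc 0" using r by simp
    also have "\<dots> \<le> 20 * r * R ^ Suc 0 * (\<Prod>i<r-2. 20 * r * R ^ Suc (Suc i))"
      using r R_pos by (simp add: Suc_le_eq)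
    also have "\<dots> = G"
    proof -
      have "r - 1 = Suc (r - 2)" using r by simp
      then show ?thesis unfolding G_def by (simp only: prod.lessThan_Suc_shift)
    qed
    finally show ?thesis using R_ge r by linarith
  qed
  have N_ge: "2 \<le> N"
  proof -
    have "5 * 1 \<le> N" unfolding N_def q_def mult.assoc
      using r k_pos R_pos by (intro mult_le_mono2) (simp add: Suc_le_eq)
    then show ?thesis by simp
  qed
  have D_ge: "2 \<le> D" using b_pos[of 0] by (simp add: D_def)
  interpret linear_hypergraph "grid D N" "axis_lines D N" N D
    by (rule linear_hypergraph_grid[OF N_ge])
  interpret sampling "grid D N" "axis_lines D N" N D r "\<lambda>j. 4 * b j" b q R k "5 * r * Z" Z G
  proof
    fix j :: nat assume j: "Suc j < r"
    have "2 * b (Suc j) \<le> 20 * k * r * R ^ Suc j * b (Suc j)"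
    proof (rule mult_le_mono1)
      have "20 * 1 \<le> 20 * (k * r * R ^ Suc j)"
        using k_pos r R_pos by (intro mult_le_mono2) (simp add: Suc_le_eq)
      then show "2 \<le> 20 * k * r * R ^ Suc j" by (simp add: mult.assoc)
    qed
    then show "4 * b (Suc j) + 2 * b j \<le> 4 * b j" using b_rec[OF j] by linarith
    show "q j = R * q (Suc j)"
    proof -
      have "r - j = Suc (r - Suc j)" using j by simp
      then show ?thesis by (simp add: q_def)
    qed
    show "b j * q (Suc j) = 20 * k * r * N * b (Suc j)"
    proof -
      have "R ^ Suc j * R ^ (r - Suc j) = R ^ r"
        using j by (simp only: power_add[symmetric]) simp
      then show ?thesis unfolding b_rec[OF j] by (simp add: N_def q_def) 
    qed
  next
    show "card (grid D N) = 5 * r * Z * N * k"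
    proof -
      have "D = Suc (Suc (D - 2))" using D_ge by simp
      then have "card (grid D N) = N ^ Suc (Suc (D - 2))" by (simp only: card_grid)
      also have "\<dots> = N * (5 * r * k * R ^ r) * N ^ (D - 2)" by (simp add: N_def q_def)
      finally show ?thesis by (simp add: Z_def)
    qed
    show "0 < Z" using R_pos N_ge by (simp add: Z_def)
    show "5832 * (r - 1) \<le> R" using R_ge r by linarith
    show "D = 4 * k ^ (r - 1) * G"
    proof -
      have "b 0 = (\<Prod>i<r-1. k * (20 * r * R ^ Suc i))"
        unfolding b_def lessThan_atLeast0 by (intro prod.cong refl) simp
      also have "\<dots> = k ^ (r - 1) * G" unfolding G_def by (simp only: prod.distrib prod_constant card_lessThan)
      finally show ?thesis by (simp add: D_def)
    qed
  qed (use r b_pos q_pos G_ge in \<open>auto simp: D_def N_def b_def k_def\<close>)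
  obtain Ls P where "Ls \<subseteq> axis_lines D N" "P \<subseteq> grid D N" "\<forall>L\<in>Ls. card (L \<inter> P) = r"
    and deg: "\<forall>p\<in>P. card {p'\<in>P. p' \<noteq> p \<and> (\<exists>L\<in>Ls. p \<in> L \<and> p' \<in> L)} \<le> 5 * r * k * (r - 1)"
    and "\<not> (\<exists>P1 P2. P1 \<union> P2 = P \<and> P1 \<inter> P2 = {} \<and> (\<forall>L\<in>Ls. (\<exists>x\<in>P1. x \<in> L) \<and> (\<exists>y\<in>P2. y \<in> L)))"
    using unsplittable_configuration by (elim exE conjE)
  moreover have "5 * r * k * (r - 1) \<le> r ^ (5 * r\<^sup>2)"
    using degree_estimate[OF r] by (simp only: k_def G_def R_def)
  then have "\<forall>p\<in>P. card {p'\<in>P. p' \<noteq> p \<and> (\<exists>L\<in>Ls. p \<in> L \<and> p' \<in> L)} \<le> r ^ (5 * r\<^sup>2)"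
    using deg le_trans by blast
  ultimately show ?thesis
    by (intro exI[of _ D] exI[of _ N] exI[of _ Ls] exI[of _ P] conjI)
qed

section \<open>Small values of \<open>r\<close> and transfer to the plane\<close>

lemma is_line_coordinate:
  "is_line {p :: real \<times> real. snd p = 0}" "is_line {p :: real \<times> real. fst p = 0}"
  "is_line {p :: real \<times> real. fst p + snd p = 1}"
proof -
  have "{p :: real \<times> real. snd p = 0} = {(0,0) + t *\<^sub>R (1,0) | t. True}" by auto
  then show "is_line {p :: real \<times> real. snd p = 0}" unfolding is_line_def
    by (intro exI[of _ "(0,0)"] exI[of _ "(1,0)"]) simp
  have "{p :: real \<times> real. fst p = 0} = {(0,0) + t *\<^sub>R (0,1) | t. True}" by auto
  then show "is_line {p :: real \<times> real. fst p = 0}" unfolding is_line_def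
    by (intro exI[of _ "(0,0)"] exI[of _ "(0,1)"]) simp
  have "{p :: real \<times> real. fst p + snd p = 1} = {(1,0) + t *\<^sub>R (-1,1) | t. True}" by auto
  then show "is_line {p :: real \<times> real. fst p + snd p = 1}" unfolding is_line_def
    by (intro exI[of _ "(1,0)"] exI[of _ "(-1,1)"]) simp
qed

theorem theorem2p6:
  fixes r :: nat
  assumes "r > 0"
  defines "T \<equiv> r ^ (5 * r\<^sup>2)"
  shows "\<exists>(\<L> :: (real \<times> real) set set) (\<P> :: (real \<times> real) set).
           finite \<L> \<and> finite \<P> \<and> (\<forall>L\<in>\<L>. is_line L) \<and>
           (\<forall>L\<in>\<L>. card (L \<inter> \<P>) \<ge> r) \<and>
           (\<forall>p\<in>\<P>. card {q\<in>\<P>. q \<noteq> p \<and> (\<exists>L\<in>\<L>. p \<in> L \<and> q \<in> L)} \<le> T) \<and>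
           \<not> (\<exists>P1 P2. P1 \<union> P2 = \<P> \<and> P1 \<inter> P2 = {} \<and>
                 (\<forall>L\<in>\<L>. (\<exists>x\<in>P1. x \<in> L) \<and> (\<exists>y\<in>P2. y \<in> L)))"
proof -
  consider "r = 1" | "r = 2" | "3 \<le> r" using assms(1) by linarith
  then show ?thesis
  proof cases
    case 1
    let ?L = "{p :: real \<times> real. snd p = 0}" and ?P = "{(0,0)} :: (real \<times> real) set"
    have "{q\<in>?P. q \<noteq> p \<and> (\<exists>L\<in>{?L}. p \<in> L \<and> q \<in> L)} = {}" if "p \<in> ?P" for p
      using that by auto
    then have "\<forall>p\<in>?P. card {q\<in>?P. q \<noteq> p \<and> (\<exists>L\<in>{?L}. p \<in> L \<and> q \<in> L)} \<le> T"
      by (metis (no_types, lifting) card.empty le0)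
    moreover have "?L \<inter> ?P = ?P" by auto
    moreover have "\<not> (\<exists>P1 P2. P1 \<union> P2 = ?P \<and> P1 \<inter> P2 = {} \<and>
        (\<forall>L\<in>{?L}. (\<exists>x\<in>P1. x \<in> L) \<and> (\<exists>y\<in>P2. y \<in> L)))"
    proof (intro notI, elim exE conjE)
      fix P1 P2 :: "(real \<times> real) set"
      assume P: "P1 \<union> P2 = ?P" "P1 \<inter> P2 = {}"
        and "\<forall>L\<in>{?L}. (\<exists>x\<in>P1. x \<in> L) \<and> (\<exists>y\<in>P2. y \<in> L)"
      then have "P1 \<noteq> {}" "P2 \<noteq> {}" by auto
      moreover have "P1 \<subseteq> ?P" "P2 \<subseteq> ?P" using P(1) by auto
      ultimately show False using P(2) by (simp add: subset_singleton_iff)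
    qed
    ultimately show ?thesis using 1 is_line_coordinate
      by (intro exI[of _ "{?L}"] exI[of _ ?P] conjI) simp_all
  next
    \<comment> \<open>The three sides of a triangle: two of its vertices fall into the same class,
      and the side through them misses the other class.\<close>
    case 2
    let ?A = "{p :: real \<times> real. snd p = 0}" and ?B = "{p :: real \<times> real. fst p = 0}"
      and ?C = "{p :: real \<times> real. fst p + snd p = 1}"
      and ?P = "{(0,0), (1,0), (0,1)} :: (real \<times> real) set"
    have int: "?A \<inter> ?P = {(0,0), (1,0)}" "?B \<inter> ?P = {(0,0), (0,1)}" "?C \<inter> ?P = {(1,0), (0,1)}"
      by auto
    have "card {q\<in>?P. Q q} \<le> T" for Q
    proof -
      have "card {q\<in>?P. Q q} \<le> card ?P" by (intro card_mono) auto
      also have "\<dots> \<le> T" using 2 by (simp add: T_def)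
      finally show ?thesis .
    qed
    then have "\<forall>p\<in>?P. card {q\<in>?P. q \<noteq> p \<and> (\<exists>L\<in>{?A, ?B, ?C}. p \<in> L \<and> q \<in> L)} \<le> T"
      by (intro ballI)
    moreover have "\<forall>L\<in>{?A, ?B, ?C}. card (L \<inter> ?P) \<ge> r"
      using 2 by (simp only: ball_simps int) simp
    moreover have "\<not> (\<exists>P1 P2. P1 \<union> P2 = ?P \<and> P1 \<inter> P2 = {} \<and>
        (\<forall>L\<in>{?A, ?B, ?C}. (\<exists>x\<in>P1. x \<in> L) \<and> (\<exists>y\<in>P2. y \<in> L)))"
    proof
      assume "\<exists>P1 P2. P1 \<union> P2 = ?P \<and> P1 \<inter> P2 = {} \<and>
        (\<forall>L\<in>{?A, ?B, ?C}. (\<exists>x\<in>P1. x \<in> L) \<and> (\<exists>y\<in>P2. y \<in> L))"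
      then obtain P1 P2 where P: "P1 \<union> P2 = ?P" "P1 \<inter> P2 = {}"
        and cov: "\<forall>L\<in>{?A, ?B, ?C}. (\<exists>x\<in>P1. x \<in> L) \<and> (\<exists>y\<in>P2. y \<in> L)" by (elim exE conjE)
      have "P1 \<inter> (L \<inter> ?P) \<noteq> {} \<and> P2 \<inter> (L \<inter> ?P) \<noteq> {}" if "L \<in> {?A, ?B, ?C}" for L
        using bspec[OF cov that] P(1) by blast
      from this[of ?A] this[of ?B] this[of ?C]
      have "P1 \<inter> {(0,0), (1,0)} \<noteq> {} \<and> P2 \<inter> {(0,0), (1,0)} \<noteq> {}"
        "P1 \<inter> {(0,0), (0,1)} \<noteq> {} \<and> P2 \<inter> {(0,0), (0,1)} \<noteq> {}"
        "P1 \<inter> {(1,0), (0,1)} \<noteq> {} \<and> P2 \<inter> {(1,0), (0,1)} \<noteq> {}"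
        unfolding int by simp_all
      then show False using P(2) by auto
    qed
    ultimately show ?thesis using is_line_coordinate
      by (intro exI[of _ "{?A, ?B, ?C}"] exI[of _ ?P] conjI) simp_all
  next
    case 3
    obtain D N Ls P where sub: "Ls \<subseteq> axis_lines D N" "P \<subseteq> grid D N"
      and card: "\<forall>L\<in>Ls. card (L \<inter> P) = r"
      and deg: "\<forall>p\<in>P. card {p'\<in>P. p' \<noteq> p \<and> (\<exists>L\<in>Ls. p \<in> L \<and> p' \<in> L)} \<le> T"
      and unsplit: "\<not> (\<exists>P1 P2. P1 \<union> P2 = P \<and> P1 \<inter> P2 = {} \<and>
        (\<forall>L\<in>Ls. (\<exists>x\<in>P1. x \<in> L) \<and> (\<exists>y\<in>P2. y \<in> L)))"
      using grid_configuration[OF 3] unfolding T_def by (elim exE conjE)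
    obtain \<phi> :: "(nat \<Rightarrow> nat) \<Rightarrow> real \<times> real" and g where "inj_on \<phi> (grid D N)"
      and g: "\<forall>L\<in>axis_lines D N. is_line (g L) \<and> (\<forall>v\<in>grid D N. \<phi> v \<in> g L \<longleftrightarrow> v \<in> L)"
      using plane_embedding[of D N] by (elim exE conjE)
    then have inj: "inj_on \<phi> P" using sub by (auto intro: inj_on_subset)
    have line: "is_line (g L)" and inc: "v \<in> P \<Longrightarrow> \<phi> v \<in> g L \<longleftrightarrow> v \<in> L" if "L \<in> Ls" for L v
      using g sub that by auto
    have finP: "finite P" using sub(2) finite_grid by (rule finite_subset)
    have "axis_lines D N \<subseteq> Pow (grid D N)" by (auto simp: axis_lines_def axis_line_def)
    then have finLs: "finite Ls" using sub(1) finite_grid by (meson finite_Pow_iff finite_subset)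
    have int: "g L \<inter> \<phi> ` P = \<phi> ` (L \<inter> P)" if "L \<in> Ls" for L
      using inc[OF that] by auto
    have "card (g L \<inter> \<phi> ` P) = r" if "L \<in> Ls" for L
      using card that int[OF that] inj_on_subset[OF inj, of "L \<inter> P"] by (simp add: card_image)
    moreover have "card {y \<in> \<phi> ` P. y \<noteq> \<phi> p \<and> (\<exists>L\<in>g ` Ls. \<phi> p \<in> L \<and> y \<in> L)} \<le> T" if p: "p \<in> P" for p
    proof -
      have "{y \<in> \<phi> ` P. y \<noteq> \<phi> p \<and> (\<exists>L\<in>g ` Ls. \<phi> p \<in> L \<and> y \<in> L)}
          \<subseteq> \<phi> ` {p'\<in>P. p' \<noteq> p \<and> (\<exists>L\<in>Ls. p \<in> L \<and> p' \<in> L)}"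
      proof
        fix y assume "y \<in> {y \<in> \<phi> ` P. y \<noteq> \<phi> p \<and> (\<exists>L\<in>g ` Ls. \<phi> p \<in> L \<and> y \<in> L)}"
        then obtain p' L where y: "y = \<phi> p'" "p' \<in> P" "\<phi> p' \<noteq> \<phi> p" and L: "L \<in> Ls" "\<phi> p \<in> g L" "\<phi> p' \<in> g L"
          by auto
        then have "p' \<in> {p'\<in>P. p' \<noteq> p \<and> (\<exists>L\<in>Ls. p \<in> L \<and> p' \<in> L)}"
          using inc[OF L(1)] p by auto
        then show "y \<in> \<phi> ` {p'\<in>P. p' \<noteq> p \<and> (\<exists>L\<in>Ls. p \<in> L \<and> p' \<in> L)}"
          using y(1) by blast
      qed
      then have "card {y \<in> \<phi> ` P. y \<noteq> \<phi> p \<and> (\<exists>L\<in>g ` Ls. \<phi> p \<in> L \<and> y \<in> L)}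
          \<le> card {p'\<in>P. p' \<noteq> p \<and> (\<exists>L\<in>Ls. p \<in> L \<and> p' \<in> L)}"
        by (rule surj_card_le[rotated]) (use finP in simp)
      then show ?thesis using bspec[OF deg p] by (rule le_trans)
    qed
    moreover have "\<not> (\<exists>P1 P2. P1 \<union> P2 = \<phi> ` P \<and> P1 \<inter> P2 = {} \<and>
        (\<forall>L\<in>g ` Ls. (\<exists>x\<in>P1. x \<in> L) \<and> (\<exists>y\<in>P2. y \<in> L)))"
    proof
      assume "\<exists>P1 P2. P1 \<union> P2 = \<phi> ` P \<and> P1 \<inter> P2 = {} \<and>
        (\<forall>L\<in>g ` Ls. (\<exists>x\<in>P1. x \<in> L) \<and> (\<exists>y\<in>P2. y \<in> L))"
      then obtain P1 P2 where P: "P1 \<union> P2 = \<phi> ` P" "P1 \<inter> P2 = {}"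
        and cov: "\<forall>L\<in>g ` Ls. (\<exists>x\<in>P1. x \<in> L) \<and> (\<exists>y\<in>P2. y \<in> L)" by (elim exE conjE)
      let ?Q = "\<lambda>A. {p\<in>P. \<phi> p \<in> A}"
      have pull: "\<exists>x\<in>?Q A. x \<in> L" if L: "L \<in> Ls" and A: "A \<subseteq> \<phi> ` P" "\<exists>y\<in>A. y \<in> g L" for A L
      proof -
        obtain p where "p \<in> P" "\<phi> p \<in> A" "\<phi> p \<in> g L" using A by blast
        then show ?thesis using inc[OF L] by blast
      qed
      have "\<forall>L\<in>Ls. (\<exists>x\<in>?Q P1. x \<in> L) \<and> (\<exists>y\<in>?Q P2. y \<in> L)"
        using cov P(1) by (intro ballI conjI pull) auto
      moreover have "?Q P1 \<union> ?Q P2 = P" "?Q P1 \<inter> ?Q P2 = {}" using P by blast+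
      ultimately have "\<exists>P1 P2. P1 \<union> P2 = P \<and> P1 \<inter> P2 = {} \<and>
          (\<forall>L\<in>Ls. (\<exists>x\<in>P1. x \<in> L) \<and> (\<exists>y\<in>P2. y \<in> L))"
        by (intro exI[of _ "?Q P1"] exI[of _ "?Q P2"] conjI)
      then show False using unsplit by contradiction
    qed
    ultimately show ?thesis using finP finLs line sub(1)
      by (intro exI[of _ "g ` Ls"] exI[of _ "\<phi> ` P"] conjI ballI) auto
  qed
qed

end
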